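(* Let $A,B\in\mathbb{C}^{n\times n}$ be matrices of quasiseparable rank $k_A$ and $k_B$, respectively, and let $E,F\subseteq\mathbb{C}$ be disjoint sets such that $\mathcal{W}(A)\subseteq E$ and $\mathcal{W}(-B)\subseteq F$. Let $C\in\mathbb{C}^{n\times n}$ have quasiseparable rank $k_C$, and let $X$ be the solution of the Sylvester equation $AX+XB=C$. Then every nonzero off-diagonal block $Y$ of $X$ satisfies $$\frac{\sigma_{1+k\ell}(Y)}{\sigma_1(Y)}\le \mathcal{C}^2\cdot Z_\ell(E,F)\qquad\text{for all integers }\ell\ge1,\qquad k:=k_A+k_B+k_C,$$ where $\mathcal{C}$ is Crouzeix's universal constant.
   Context: The quasiseparable rank of a square matrix is the maximum of the ranks of all its submatrices contained in its strictly upper or strictly lower triangular part. An off-diagonal block of an $n\times n$ matrix $X$ is one of the two off-diagonal blocks $X_{12},X_{21}$ of a $2\times2$ block partitioning $X=\begin{bmatrix} X_{11} & X_{12} \\ X_{21} & X_{22} \end{bmatrix}$ with square diagonal blocks, i.e. the submatrix with rows $p+1,\dots,n$ and columns $1,\dots,p$, or rows $1,\dots,p$ and columns $p+1,\dots,n$, for some $1\le p\le n-1$. $\sigma_1(M)\ge\sigma_2(M)\ge\cdots$ denote the singular values of $M$ in non-increasing order, with $\sigma_j(M)=0$ if $j$ exceeds the smaller dimension of $M$. The field of values of a square matrix $A$ is $\mathcal{W}(A):=\left\{\frac{x^HAx}{x^Hx}\ :\ x\in\mathbb{C}^n\setminus\{0\}\right\}$. For disjoint sets $E,F\subseteq\mathbb{C}$,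 the Zolotarev number is $$Z_\ell(E,F):=\inf_{r\in\mathcal{R}_{\ell,\ell}}\frac{\max_{x\in E}|r(x)|}{\min_{y\in F}|r(y)|},$$ where $\mathcal{R}_{\ell,\ell}$ is the set of rational functions of degree at most $(\ell,\ell)$ (numerator and denominator each of degree at most $\ell$); the max and min are read as supremum and infimum if not attained, and the infimum is over those $r$ for which the quotient is well defined. Crouzeix's constant $\mathcal{C}$ is the universal constant such that $\|f(M)\|_2\le\mathcal{C}\max_{z\in\mathcal{W}(M)}|f(z)|$ for every square complex matrix $M$ and every function $f$ holomorphic on (a neighbourhood of) $\mathcal{W}(M)$; it is known that $\mathcal{C}\le1+\sqrt2$. *)

theory Defs
  imports
    "HOL-Analysis.Complex_Analysis_Basics"
    "HOL-Library.Extended_Nonnegative_Real"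
    "Jordan_Normal_Form.Schur_Decomposition"
    "Jordan_Normal_Form.DL_Rank_Submatrix"
begin

subsection \<open>Quasiseparable rank and off-diagonal blocks\<close>

definition quasiseparable_rank :: "complex mat \<Rightarrow> nat" where
  "quasiseparable_rank A =
     Max {vec_space.rank (dim_row (submatrix A I J)) (submatrix A I J) | I J.
            I \<subseteq> {..<dim_row A} \<and> J \<subseteq> {..<dim_col A} \<and>
            ((\<forall>i\<in>I. \<forall>j\<in>J. i < j) \<or> (\<forall>i\<in>I. \<forall>j\<in>J. j < i))}"

definition off_diagonal_blocks :: "complex mat \<Rightarrow> complex mat set" where
  "off_diagonal_blocks X =
     {Y. \<exists>p X11 X12 X21 X22. 1 \<le> p \<and> p < dim_row X \<and>
           split_block X p p = (X11, X12, X21, X22) \<and> (Y = X12 \<or> Y = X21)}"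

subsection \<open>Singular values\<close>

text \<open>The square roots of the eigenvalues of \<open>M\<^sup>H M\<close>, counted with algebraic multiplicity and in
  non-increasing order. These eigenvalues are real and nonnegative, so \<open>Re\<close> discards nothing. The
  list has \<open>dim_col M\<close> entries; those beyond \<open>min (dim_row M) (dim_col M)\<close> are zero.\<close>

definition singular_values :: "complex mat \<Rightarrow> real list" where
  "singular_values M =
     rev (sorted_list_of_multiset
       (image_mset (\<lambda>z. sqrt (Re z)) (proots (char_poly (mat_adjoint M * M)))))"

definition singular_value :: "nat \<Rightarrow> complex mat \<Rightarrow> real" where
  "singular_value j M =
     (if 1 \<le> j \<and> j \<le> min (dim_row M) (dim_col M) then singular_values M ! (j - 1) else 0)"

subsection \<open>Field of values\<close>

text \<open>\<open>v \<bullet>c w\<close> conjugates its second argument, so \<open>(A *\<^sub>v x) \<bullet>c x\<close> is \<open>x\<^sup>H A x\<close>.\<close>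

definition field_of_values :: "complex mat \<Rightarrow> complex set" where
  "field_of_values A =
     {((A *\<^sub>v x) \<bullet>c x) / (x \<bullet>c x) | x. x \<in> carrier_vec (dim_row A) \<and> x \<noteq> 0\<^sub>v (dim_row A)}"

subsection \<open>Zolotarev numbers\<close>

text \<open>A rational function is a reduced fraction \<open>p / q\<close>, and its modulus is read with values in
  \<open>[0, \<infinity>]\<close>, being \<open>\<infinity>\<close> at a pole: poles in \<open>F\<close> are allowed, as in the classical
  extremal problem. The quotients \<open>0 / 0\<close> and \<open>\<infinity> / \<infinity>\<close> are undefined and have to be
  excluded explicitly, since both equal \<open>0\<close> in \<open>ennreal\<close>.\<close>

definition ratfun_abs :: "complex poly \<Rightarrow> complex poly \<Rightarrow> complex \<Rightarrow> ennreal" where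
  "ratfun_abs p q z =
     (if poly q z = 0 then \<infinity> else ennreal (cmod (poly p z / poly q z)))"

definition zolotarev :: "nat \<Rightarrow> complex set \<Rightarrow> complex set \<Rightarrow> ennreal" where
  "zolotarev l E F =
     Inf {S / T | p q S T.
            degree p \<le> l \<and> degree q \<le> l \<and> q \<noteq> 0 \<and> coprime p q \<and>
            S = (SUP x\<in>E. ratfun_abs p q x) \<and> T = (INF y\<in>F. ratfun_abs p q y) \<and>
            \<not> (S = 0 \<and> T = 0) \<and> \<not> (S = \<infinity> \<and> T = \<infinity>)}"

subsection \<open>Functions of matrices and Crouzeix's constant\<close>

definition poly_of_mat :: "complex poly \<Rightarrow> complex mat \<Rightarrow> complex mat" where
  "poly_of_mat p M = mat (dim_row M) (dim_row M)
     (\<lambda>(a, b). \<Sum>i\<le>degree p. coeff p i * (M ^\<^sub>m i) $$ (a, b))"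

text \<open>For \<open>f\<close> holomorphic near the spectrum of \<open>M\<close>, \<open>f(M) = p(M)\<close> for any polynomial \<open>p\<close> that
  Hermite-interpolates \<open>f\<close> at each eigenvalue to the order of its algebraic multiplicity. Any two
  such polynomials differ by a multiple of the characteristic polynomial, so by the Cayley--Hamilton
  theorem the choice of \<open>p\<close> does not matter. Points \<open>z\<close> that are not eigenvalues have
  \<open>order z (char_poly M) = 0\<close> and impose no condition.\<close>

definition hermite_interpolates :: "complex poly \<Rightarrow> (complex \<Rightarrow> complex) \<Rightarrow> complex mat \<Rightarrow> bool" where
  "hermite_interpolates p f M \<longleftrightarrow>
     (\<forall>z. \<forall>i < order z (char_poly M). poly ((pderiv ^^ i) p) z = (deriv ^^ i) f z)"

definition mat_fun :: "(complex \<Rightarrow> complex) \<Rightarrow> complex mat \<Rightarrow> complex mat" where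
  "mat_fun f M = poly_of_mat (SOME p. hermite_interpolates p f M) M"

definition vec_norm2 :: "complex Matrix.vec \<Rightarrow> real" where
  "vec_norm2 v = sqrt (\<Sum>i<dim_vec v. (cmod (v $ i))\<^sup>2)"

definition mat_norm2 :: "complex mat \<Rightarrow> real" where
  "mat_norm2 M = Sup {vec_norm2 (M *\<^sub>v x) | x. x \<in> carrier_vec (dim_col M) \<and> vec_norm2 x = 1}"

text \<open>The least constant for which the defining inequality holds universally. Taking the infimum in
  \<open>[0, \<infinity>]\<close> makes it well defined without appeal to Crouzeix's theorem, which says that it is
  finite.\<close>

definition crouzeix_constant :: ennreal where
  "crouzeix_constant =
     Inf {c. \<forall>n M f S. n \<ge> 1 \<longrightarrow> M \<in> carrier_mat n n \<longrightarrow> open S \<longrightarrow> field_of_values M \<subseteq> S \<longrightarrow>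
               f holomorphic_on S \<longrightarrow>
               ennreal (mat_norm2 (mat_fun f M)) \<le> c * (SUP z\<in>field_of_values M. ennreal (cmod (f z)))}"

end

theory Submission
  imports Defs "HOL-Complex_Analysis.Cauchy_Integral_Formula" "HOL-Computational_Algebra.Field_as_Ring"
begin

text \<open>An off-diagonal block \<open>Y\<close> of \<open>X\<close>, say the lower left one, satisfies the Sylvester equation
  \<open>A\<^sub>2\<^sub>2 Y + Y B\<^sub>1\<^sub>1 = C\<^sub>2\<^sub>1 - A\<^sub>2\<^sub>1 X\<^sub>1\<^sub>1 - X\<^sub>2\<^sub>2 B\<^sub>2\<^sub>1\<close>, whose right-hand side has rank at most \<open>k\<close>; compressing to diagonal
  blocks only shrinks the fields of values. Write \<open>A\<close> for \<open>A\<^sub>2\<^sub>2\<close> and \<open>D\<close> for \<open>- B\<^sub>1\<^sub>1\<close>. If \<open>r = P / Q\<close> has degree at most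
  \<open>(l, l)\<close>, then \<open>P(A) Y Q(D) - Q(A) Y P(D)\<close> has rank at most \<open>k l\<close>, hence so has
  \<open>Y - r(A) Y r(D)\<^sup>-\<^sup>1\<close>. By Eckart and Young, \<open>\<sigma>\<^bsub>1 + k l\<^esub>(Y)\<close> is at most
  \<open>\<parallel>r(A)\<parallel> \<sigma>\<^sub>1(Y) \<parallel>r(D)\<^sup>-\<^sup>1\<parallel>\<close>, and Crouzeix's inequality bounds the two outer factors. The finiteness of
  Crouzeix's constant is not needed: if it were infinite, the claim would only have content for a
  vanishing Zolotarev number, which forces \<open>A\<close> or \<open>D\<close> to be scalar and \<open>Y\<close> to have rank at most
  \<open>k\<close>.\<close>

text \<open>Only \<open>r(A)\<close> and \<open>(1/r)(D)\<close> enter the estimate. Poles of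
  \<open>r\<close> in \<open>F\<close> are therefore harmless, while poles in \<open>E\<close> and
  zeros in \<open>F\<close> cannot occur once the quotient for \<open>r\<close> is finite. Since
  eigenvalues lie in the field of values, this makes \<open>Q(A)\<close> and \<open>P(D)\<close>
  invertible. A matrix function is evaluated through an unspecified Hermite interpolant, so
  \<open>r(A)\<close> is accessible only through the identity \<open>Q(A) r(A) = P(A)\<close>. The
  divisibility arguments and the Cayley-Hamilton theorem serve to establish it. The case distinction
  on Crouzeix's constant comes from the passage from a single \<open>r\<close> to the infimum: in
  \<open>[0, \<infinity>]\<close> multiplication by infinity does not commute with an infimum that
  equals 0 without being attained. In that case the left-hand side itself has to be shown to vanish,
  whence the lower bound for Zolotarev numbers of infinite sets and the classification of matrices
  with finite field of values.\<close>

no_notation Finite_Cartesian_Product.vec.vec_nth (infixl "$" 90)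
unbundle no inner_syntax

section \<open>Matrices of bounded rank\<close>

text \<open>A factorization through dimension \<open>k\<close> rather than the dimension of a column
  space: it is visibly stable under products, sums concatenate the factors, and the right factor
  \<open>V\<close> later supplies the \<open>k\<close> linear conditions of the Eckart-Young bound.
  It expresses an upper bound on the rank.\<close>

definition rank_le :: "nat \<Rightarrow> 'a :: field mat \<Rightarrow> bool" where
  "rank_le k M \<longleftrightarrow>
     (\<exists>U V. U \<in> carrier_mat (dim_row M) k \<and> V \<in> carrier_mat k (dim_col M) \<and> M = U * V)"

lemma rank_leI:
  assumes "U \<in> carrier_mat m k" "V \<in> carrier_mat k p" "M = U * V"
  shows "rank_le k M"
  using assms unfolding rank_le_def by auto

lemma rank_leE:
  assumes "rank_le k M" "M \<in> carrier_mat m p"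
  obtains U V where "U \<in> carrier_mat m k" "V \<in> carrier_mat k p" "M = U * V"
  using assms unfolding rank_le_def by auto

lemma rank_le_zero: "rank_le k (0\<^sub>m m p)"
  by (rule rank_leI[of "0\<^sub>m m k" _ _ "0\<^sub>m k p"]) auto

lemma rank_le_add:
  assumes M: "M \<in> carrier_mat m p" and N: "N \<in> carrier_mat m p"
    and rM: "rank_le a M" and rN: "rank_le b N"
  shows "rank_le (a + b) (M + N)"
proof -
  obtain U V where U: "U \<in> carrier_mat m a" and V: "V \<in> carrier_mat a p" and MUV: "M = U * V"
    using rank_leE[OF rM M] .
  obtain U' V' where U': "U' \<in> carrier_mat m b" and V': "V' \<in> carrier_mat b p" and NUV: "N = U' * V'"
    using rank_leE[OF rN N] .
  \<comment> \<open>Blocks with no rows or no columns turn \<open>four_block_mat\<close> into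
    concatenation: \<open>?L\<close> puts \<open>U\<close> and \<open>U'\<close> side by side,
    \<open>?R\<close> stacks \<open>V\<close> on \<open>V'\<close>.\<close>
  let ?L = "four_block_mat U U' (0\<^sub>m 0 a) (0\<^sub>m 0 b)"
  let ?R = "four_block_mat V (0\<^sub>m a 0) V' (0\<^sub>m b 0)"
  have "?L * ?R = four_block_mat (U * V + U' * V') (U * 0\<^sub>m a 0 + U' * 0\<^sub>m b 0)
      (0\<^sub>m 0 a * V + 0\<^sub>m 0 b * V') (0\<^sub>m 0 a * 0\<^sub>m a 0 + 0\<^sub>m 0 b * 0\<^sub>m b 0)"
    by (rule mult_four_block_mat[OF U U' _ _ V _ V']) auto
  also have "\<dots> = M + N"
    using U V U' V' by (intro eq_matI) (auto simp: MUV NUV)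
  finally have "M + N = ?L * ?R" ..
  moreover have "?L \<in> carrier_mat m (a + b)" "?R \<in> carrier_mat (a + b) p"
    using four_block_carrier_mat[of U m a "0\<^sub>m 0 b" 0 b] four_block_carrier_mat[of V a p "0\<^sub>m b 0" b 0] U V by auto
  ultimately show ?thesis by (intro rank_leI[of ?L m "a + b" ?R p])
qed

lemma rank_le_mono:
  assumes "rank_le a M" "a \<le> b"
  shows "rank_le b M"
proof -
  have "rank_le (a + (b - a)) (M + 0\<^sub>m (dim_row M) (dim_col M))"
    by (rule rank_le_add[OF _ _ assms(1) rank_le_zero]) auto
  then show ?thesis using assms(2) by simp
qed

lemma rank_le_mult_left:
  assumes L: "L \<in> carrier_mat m' m" and M: "M \<in> carrier_mat m p" and r: "rank_le k M"
  shows "rank_le k (L * M)"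
proof -
  obtain U V where U: "U \<in> carrier_mat m k" and V: "V \<in> carrier_mat k p" and MUV: "M = U * V"
    using rank_leE[OF r M] .
  show ?thesis
    by (rule rank_leI[of "L * U" m' k V p]) (use L U V MUV in auto)
qed

lemma rank_le_mult_right:
  assumes M: "M \<in> carrier_mat m p" and R: "R \<in> carrier_mat p p'" and r: "rank_le k M"
  shows "rank_le k (M * R)"
proof -
  obtain U V where U: "U \<in> carrier_mat m k" and V: "V \<in> carrier_mat k p" and MUV: "M = U * V"
    using rank_leE[OF r M] .
  show ?thesis
    by (rule rank_leI[of U m k "V * R" p']) (use R U V MUV in auto)
qed

lemma rank_le_smult:
  assumes "rank_le k M"
  shows "rank_le k (c \<cdot>\<^sub>m M)"
proof -
  obtain U V where U: "U \<in> carrier_mat (dim_row M) k" and V: "V \<in> carrier_mat k (dim_col M)"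
    and MUV: "M = U * V"
    using rank_leE[OF assms, of "dim_row M" "dim_col M"] by auto
  have "c \<cdot>\<^sub>m M = (c \<cdot>\<^sub>m U) * V"
    unfolding MUV using mult_smult_assoc_mat[OF U V] by simp
  then show ?thesis
    using U V by (intro rank_leI[of "c \<cdot>\<^sub>m U" _ k V]) auto
qed

lemma rank_le_uminus:
  assumes "rank_le k M"
  shows "rank_le k (- M)"
proof -
  have "- M = (-1) \<cdot>\<^sub>m M" by (intro eq_matI) auto
  then show ?thesis using rank_le_smult[OF assms] by simp
qed

lemma rank_le_diff:
  assumes M: "M \<in> carrier_mat m p" and N: "N \<in> carrier_mat m p"
    and rM: "rank_le a M" and rN: "rank_le b N"
  shows "rank_le (a + b) (M - N)"
proof -
  have "M - N = M + (- N)" using M N by (intro eq_matI) auto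
  then show ?thesis using rank_le_add[OF M _ rM rank_le_uminus[OF rN]] N by auto
qed

text \<open>The bridge from the column rank used in \<open>quasiseparable_rank\<close>. A maximal
  independent set of columns of \<open>M\<close> gives the left factor; by maximality every column
  lies in its span, and the coefficient vectors are the columns of the right factor.\<close>

lemma rank_le_rank:
  fixes M :: "'a :: field mat"
  assumes M: "M \<in> carrier_mat m p"
  shows "rank_le (vec_space.rank m M) M"
proof -
  interpret vec_space "TYPE('a)" m .
  have C: "set (cols M) \<subseteq> carrier_vec m" using cols_dim M by blast
  obtain S where S: "maximal S (\<lambda>T. T \<subseteq> set (cols M) \<and> lin_indpt T)"
    using maximal_exists_superset[of "set (cols M)" "\<lambda>T. T \<subseteq> set (cols M) \<and> lin_indpt T" "{}"]
    by (auto simp: lin_dep_def)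
  have SC: "S \<subseteq> set (cols M)" and ind: "lin_indpt S"
    and max: "\<And>T. S \<subseteq> T \<Longrightarrow> T \<subseteq> set (cols M) \<Longrightarrow> lin_indpt T \<Longrightarrow> T = S"
    using S unfolding maximal_def by auto
  have fin: "finite S" using SC finite_subset by auto
  obtain ss where ss: "set ss = S" "distinct ss"
    using finite_distinct_list[OF fin] by auto
  have len: "length ss = rank M"
    using rank_card_indpt[OF M S] ss distinct_card[OF ss(2)] by simp
  let ?U = "mat_of_cols m ss"
  have SV: "S \<subseteq> carrier_vec m" using SC C by auto
  have cU: "cols ?U = ss" using ss SV by simp
  have U: "?U \<in> carrier_mat m (rank M)" using len by auto
  have ex: "\<exists>v. v \<in> carrier_vec (rank M) \<and> ?U *\<^sub>v v = c" if c: "c \<in> set (cols M)" for c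
  proof -
    have "c \<in> span S"
    proof (cases "c \<in> S")
      case True
      then show ?thesis using span_mem SV by auto
    next
      case False
      then have "lin_dep (S \<union> {c})" using max[of "S \<union> {c}"] SC c by auto
      then show ?thesis
        using lin_dep_iff_in_span[of S c] SV ind c C False by auto
    qed
    then obtain a where "c = lincomb a S"
      unfolding finite_span[OF fin SV[folded module_vec_simps(3)]] by auto
    then show ?thesis
      using mat_mult_eq_lincomb[OF U, of a] unfolding cU ss using ss
      by (intro exI[of _ "Matrix.vec (rank M) (\<lambda>i. a (col ?U i))"]) auto
  qed
  then obtain v where v: "\<And>c. c \<in> set (cols M) \<Longrightarrow> v c \<in> carrier_vec (rank M)"
      "\<And>c. c \<in> set (cols M) \<Longrightarrow> ?U *\<^sub>v v c = c" by metis
  let ?V = "mat_of_cols (rank M) (map v (cols M))"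
  have V: "?V \<in> carrier_mat (rank M) p" using M by auto
  have cin: "col M j \<in> set (cols M)" if "j < p" for j
    using that M unfolding cols_def by auto
  have "M = ?U * ?V"
  proof (rule mat_col_eqI)
    fix j assume "j < dim_col (?U * ?V)"
    then have j: "j < p" using V by auto
    have "col (?U * ?V) j = ?U *\<^sub>v col ?V j" using j V U by (intro col_mult2) auto
    also have "col ?V j = v (col M j)"
      using j M v(1)[OF cin[OF j]] by (subst col_mat_of_cols) auto
    finally show "col M j = col (?U * ?V) j" using v(2)[OF cin[OF j]] by simp
  qed (use U V M in auto)
  then show ?thesis by (rule rank_leI[OF U V])
qed

section \<open>Polynomials of a matrix\<close>

lemma poly_of_mat_carrier [simp]: "A \<in> carrier_mat n n \<Longrightarrow> poly_of_mat p A \<in> carrier_mat n n"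
  by (auto simp: poly_of_mat_def)

lemma pow_mat_Suc_left:
  assumes A: "A \<in> carrier_mat n n"
  shows "A ^\<^sub>m Suc i = A * A ^\<^sub>m i"
proof (induct i)
  case (Suc i)
  have "A ^\<^sub>m Suc (Suc i) = (A * A ^\<^sub>m i) * A" using Suc by simp
  also have "\<dots> = A * A ^\<^sub>m Suc i" using A by (simp add: assoc_mult_mat[of _ n n _ n _ n])
  finally show ?case .
qed (use A in auto)

text \<open>Summing up to any bound on the degree lets polynomials of different degrees be compared
  term by term, also when the degree drops under addition or scaling.\<close>

lemma index_poly_of_mat:
  assumes "A \<in> carrier_mat n n" "a < n" "b < n" "degree p \<le> N"
  shows "poly_of_mat p A $$ (a, b) = (\<Sum>i\<le>N. coeff p i * (A ^\<^sub>m i) $$ (a, b))"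
proof -
  have "poly_of_mat p A $$ (a, b) = (\<Sum>i\<le>degree p. coeff p i * (A ^\<^sub>m i) $$ (a, b))"
    using assms by (simp add: poly_of_mat_def)
  also have "\<dots> = (\<Sum>i\<le>N. coeff p i * (A ^\<^sub>m i) $$ (a, b))"
    using assms(4) by (intro sum.mono_neutral_left) (auto simp: coeff_eq_0 not_le)
  finally show ?thesis .
qed

lemma poly_of_mat_0 [simp]: "A \<in> carrier_mat n n \<Longrightarrow> poly_of_mat 0 A = 0\<^sub>m n n"
  by (intro eq_matI) (auto simp: poly_of_mat_def)

text \<open>The Horner step, from which multiplicativity follows by induction on the coefficient
  list.\<close>

lemma poly_of_mat_pCons:
  assumes A: "A \<in> carrier_mat n n"
  shows "poly_of_mat (pCons c p) A = c \<cdot>\<^sub>m 1\<^sub>m n + A * poly_of_mat p A"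
proof (rule eq_matI)
  fix a b assume "a < dim_row (c \<cdot>\<^sub>m 1\<^sub>m n + A * poly_of_mat p A)"
    "b < dim_col (c \<cdot>\<^sub>m 1\<^sub>m n + A * poly_of_mat p A)"
  then have ab: "a < n" "b < n" using A by (auto simp: poly_of_mat_def)
  have "(A * poly_of_mat p A) $$ (a, b)
      = (\<Sum>k<n. A $$ (a, k) * (\<Sum>i\<le>degree p. coeff p i * (A ^\<^sub>m i) $$ (k, b)))"
    using A ab by (simp add: scalar_prod_def index_poly_of_mat[OF A _ _ order_refl] lessThan_atLeast0
        poly_of_mat_def)
  also have "\<dots> = (\<Sum>i\<le>degree p. coeff p i * (\<Sum>k<n. A $$ (a, k) * (A ^\<^sub>m i) $$ (k, b)))"
    unfolding sum_distrib_left by (subst sum.swap) (simp add: mult_ac)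
  also have "\<dots> = (\<Sum>i\<le>degree p. coeff p i * (A ^\<^sub>m Suc i) $$ (a, b))"
  proof (rule sum.cong[OF refl])
    fix i
    have "A ^\<^sub>m i \<in> carrier_mat n n" using A by simp
    then show "coeff p i * (\<Sum>k<n. A $$ (a, k) * (A ^\<^sub>m i) $$ (k, b)) = coeff p i * (A ^\<^sub>m Suc i) $$ (a, b)"
      using A ab by (simp only: pow_mat_Suc_left[OF A]) (simp add: scalar_prod_def lessThan_atLeast0)
  qed
  finally have *: "(A * poly_of_mat p A) $$ (a, b) = (\<Sum>i\<le>degree p. coeff p i * (A ^\<^sub>m Suc i) $$ (a, b))" .
  have "poly_of_mat (pCons c p) A $$ (a, b)
      = (\<Sum>i\<le>Suc (degree p). coeff (pCons c p) i * (A ^\<^sub>m i) $$ (a, b))"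
    by (rule index_poly_of_mat[OF A ab]) (rule degree_pCons_le)
  also have "\<dots> = c * (A ^\<^sub>m 0) $$ (a, b) + (\<Sum>i\<le>degree p. coeff p i * (A ^\<^sub>m Suc i) $$ (a, b))"
    by (subst sum.atMost_Suc_shift) simp
  also have "\<dots> = (c \<cdot>\<^sub>m 1\<^sub>m n + A * poly_of_mat p A) $$ (a, b)"
    using A ab * by (simp add: poly_of_mat_def)
  finally show "poly_of_mat (pCons c p) A $$ (a, b) = (c \<cdot>\<^sub>m 1\<^sub>m n + A * poly_of_mat p A) $$ (a, b)" .
qed (use A in \<open>auto simp: poly_of_mat_def\<close>)

lemma poly_of_mat_smult:
  assumes A: "A \<in> carrier_mat n n"
  shows "poly_of_mat (smult c p) A = c \<cdot>\<^sub>m poly_of_mat p A"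
  using A by (intro eq_matI)
    (auto simp: index_poly_of_mat[OF A _ _ degree_smult_le] index_poly_of_mat[OF A _ _ order_refl]
      sum_distrib_left mult_ac poly_of_mat_def[of _ A])

lemma poly_of_mat_add:
  assumes A: "A \<in> carrier_mat n n"
  shows "poly_of_mat (p + q) A = poly_of_mat p A + poly_of_mat q A"
proof (rule eq_matI)
  fix a b assume "a < dim_row (poly_of_mat p A + poly_of_mat q A)"
    "b < dim_col (poly_of_mat p A + poly_of_mat q A)"
  then have ab: "a < n" "b < n" using A by (auto simp: poly_of_mat_def)
  let ?N = "max (degree p) (degree q)"
  show "poly_of_mat (p + q) A $$ (a, b) = (poly_of_mat p A + poly_of_mat q A) $$ (a, b)"
    using ab A carrier_matD[OF poly_of_mat_carrier[OF A, of q]]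
    by (simp add: index_poly_of_mat[OF A, of _ _ _ ?N] degree_add_le distrib_right sum.distrib)
qed (use A in \<open>auto simp: poly_of_mat_def\<close>)

lemma poly_of_mat_mult:
  assumes A: "A \<in> carrier_mat n n"
  shows "poly_of_mat (p * q) A = poly_of_mat p A * poly_of_mat q A"
proof (induct p)
  case (pCons c p)
  have *: "poly_of_mat r A \<in> carrier_mat n n" for r using A by simp
  have zero: "0 \<cdot>\<^sub>m 1\<^sub>m n + Z = Z" if "Z \<in> carrier_mat n n" for Z :: "complex mat"
    using that by (intro eq_matI) auto
  have "poly_of_mat (pCons c p * q) A
      = c \<cdot>\<^sub>m poly_of_mat q A + (0 \<cdot>\<^sub>m 1\<^sub>m n + A * (poly_of_mat p A * poly_of_mat q A))"
    using pCons by (simp add: poly_of_mat_add[OF A] poly_of_mat_smult[OF A] poly_of_mat_pCons[OF A])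
  also have "0 \<cdot>\<^sub>m 1\<^sub>m n + A * (poly_of_mat p A * poly_of_mat q A) = (A * poly_of_mat p A) * poly_of_mat q A"
    using assoc_mult_mat[OF A * *, of p q] mult_carrier_mat[OF A mult_carrier_mat[OF *[of p] *[of q]]]
    by (simp add: zero)
  also have "c \<cdot>\<^sub>m poly_of_mat q A = (c \<cdot>\<^sub>m 1\<^sub>m n) * poly_of_mat q A"
    using mult_smult_assoc_mat[OF one_carrier_mat *[of q], of c] *[of q] by simp
  also have "(c \<cdot>\<^sub>m 1\<^sub>m n) * poly_of_mat q A + (A * poly_of_mat p A) * poly_of_mat q A
      = (c \<cdot>\<^sub>m 1\<^sub>m n + A * poly_of_mat p A) * poly_of_mat q A"
    by (rule add_mult_distrib_mat[symmetric, of _ n n _ _ n]) (use A * in auto)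
  finally show ?case by (simp add: poly_of_mat_pCons[OF A])
qed (use A left_mult_zero_mat[OF poly_of_mat_carrier[OF A, of q], of n] in simp)

lemma poly_of_mat_commute:
  assumes A: "A \<in> carrier_mat n n"
  shows "poly_of_mat p A * poly_of_mat q A = poly_of_mat q A * poly_of_mat p A"
  by (metis mult.commute poly_of_mat_mult[OF A])

lemma poly_of_mat_const:
  assumes A: "A \<in> carrier_mat n n"
  shows "poly_of_mat [:c:] A = c \<cdot>\<^sub>m 1\<^sub>m n"
  using A by (simp add: poly_of_mat_pCons[OF A])

lemma poly_of_mat_linear:
  assumes A: "A \<in> carrier_mat n n"
  shows "poly_of_mat [:c, d:] A = c \<cdot>\<^sub>m 1\<^sub>m n + d \<cdot>\<^sub>m A"
  using A mult_smult_distrib[OF A one_carrier_mat, of d] by (simp add: poly_of_mat_pCons[OF A])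

lemma poly_of_mat_1 [simp]:
  assumes A: "A \<in> carrier_mat n n"
  shows "poly_of_mat 1 A = 1\<^sub>m n"
  using poly_of_mat_const[OF A, of 1] by (simp add: one_pCons) (intro eq_matI; auto)

text \<open>The adjugate argument: compare coefficients of powers of z in (z - A) adj(z - A) =
  chi(z) I, multiply the i-th identity by the i-th power of \<open>A\<close>, and let the sum
  telescope.\<close>

theorem Cayley_Hamilton:
  assumes A: "A \<in> carrier_mat n n"
  shows "poly_of_mat (char_poly A) A = 0\<^sub>m n n"
proof -
  define B where "B = adj_mat (char_poly_matrix A)"
  have CA: "char_poly_matrix A \<in> carrier_mat n n" using A by simp
  have B: "B \<in> carrier_mat n n" unfolding B_def by (rule adj_mat(1)[OF CA])
  have eq: "char_poly_matrix A * B = char_poly A \<cdot>\<^sub>m 1\<^sub>m n"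
    unfolding B_def char_poly_def by (rule adj_mat(2)[OF CA])
  \<comment> \<open>The adjugate \<open>B\<close> has polynomial entries; \<open>Bc i\<close> is its
    matrix coefficient at the i-th power of the variable.\<close>
  define Bc where "Bc i = map_mat (\<lambda>r. coeff r i) B" for i
  have Bc: "Bc i \<in> carrier_mat n n" for i using B by (simp add: Bc_def)
  have ent: "[:0,1:] * B $$ (a, b) - (\<Sum>k<n. [:A $$ (a, k):] * B $$ (k, b)) = (if a = b then char_poly A else 0)"
    if ab: "a < n" "b < n" for a b
  proof -
    have "(char_poly_matrix A * B) $$ (a, b)
        = (\<Sum>k<n. ((if a = k then [:0,1:] else 0) + [:- (A $$ (a, k)):]) * B $$ (k, b))"
      using ab A B carrier_matD[OF CA] by (simp add: scalar_prod_def lessThan_atLeast0)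
        (rule sum.cong, auto simp: char_poly_matrix_def)
    also have "\<dots> = (\<Sum>k<n. (if a = k then [:0,1:] * B $$ (k, b) else 0) - [:A $$ (a, k):] * B $$ (k, b))"
      by (rule sum.cong) (auto simp: algebra_simps simp flip: minus_pCons)
    also have "\<dots> = [:0,1:] * B $$ (a, b) - (\<Sum>k<n. [:A $$ (a, k):] * B $$ (k, b))"
      using ab by (simp add: sum_subtractf)
    finally show ?thesis using eq ab by auto
  qed
  have c0: "coeff (char_poly A) 0 \<cdot>\<^sub>m 1\<^sub>m n = - (A * Bc 0)"
  proof (rule eq_matI)
    fix a b assume "a < dim_row (- (A * Bc 0))" "b < dim_col (- (A * Bc 0))"
    then have ab: "a < n" "b < n" using A Bc[of 0] by auto
    then show "(coeff (char_poly A) 0 \<cdot>\<^sub>m 1\<^sub>m n) $$ (a, b) = (- (A * Bc 0)) $$ (a, b)"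
      using arg_cong[OF ent[OF ab], of "\<lambda>r. coeff r 0"] A B Bc[of 0]
      by (auto simp: scalar_prod_def lessThan_atLeast0 coeff_sum Bc_def split: if_splits)
  qed (use A Bc[of 0] in auto)
  have cS: "coeff (char_poly A) (Suc i) \<cdot>\<^sub>m 1\<^sub>m n = Bc i - A * Bc (Suc i)" for i
  proof (rule eq_matI)
    fix a b assume "a < dim_row (Bc i - A * Bc (Suc i))" "b < dim_col (Bc i - A * Bc (Suc i))"
    then have ab: "a < n" "b < n" using A Bc[of "Suc i"] by auto
    then show "(coeff (char_poly A) (Suc i) \<cdot>\<^sub>m 1\<^sub>m n) $$ (a, b) = (Bc i - A * Bc (Suc i)) $$ (a, b)"
      using arg_cong[OF ent[OF ab], of "\<lambda>r. coeff r (Suc i)"] A B Bc[of i] Bc[of "Suc i"]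
      by (auto simp: scalar_prod_def lessThan_atLeast0 coeff_sum Bc_def split: if_splits)
  qed (use A Bc[of i] Bc[of "Suc i"] in auto)
  define S where "S N = Matrix.mat n n (\<lambda>(a, b). \<Sum>i\<le>N. coeff (char_poly A) i * (A ^\<^sub>m i) $$ (a, b))" for N
  have alg: "- X + (X - Y) = - Y" if "X \<in> carrier_mat n n" "Y \<in> carrier_mat n n" for X Y :: "complex mat"
    using that by (intro eq_matI) auto
  \<comment> \<open>After telescoping only the last adjugate coefficient survives.\<close>
  have S: "S N = - (A ^\<^sub>m Suc N * Bc N)" for N
  proof (induct N)
    case 0
    have "S 0 = coeff (char_poly A) 0 \<cdot>\<^sub>m 1\<^sub>m n" using A by (intro eq_matI) (auto simp: S_def)
    then show ?case using c0 A by simp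
  next
    case (Suc N)
    have AN: "A ^\<^sub>m Suc N \<in> carrier_mat n n" using A by (intro pow_carrier_mat)
    have AB: "A * Bc (Suc N) \<in> carrier_mat n n" using A Bc by simp
    have "S (Suc N) = S N + coeff (char_poly A) (Suc N) \<cdot>\<^sub>m A ^\<^sub>m Suc N"
      using A AN by (intro eq_matI) (auto simp: S_def simp del: pow_mat.simps)
    also have "coeff (char_poly A) (Suc N) \<cdot>\<^sub>m A ^\<^sub>m Suc N
        = A ^\<^sub>m Suc N * (coeff (char_poly A) (Suc N) \<cdot>\<^sub>m 1\<^sub>m n)"
      using mult_smult_distrib[OF AN one_carrier_mat] right_mult_one_mat[OF AN] by (simp del: pow_mat.simps)
    also have "\<dots> = A ^\<^sub>m Suc N * Bc N - A ^\<^sub>m Suc N * (A * Bc (Suc N))"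
      unfolding cS by (rule mult_minus_distrib_mat[OF AN Bc AB])
    also have "A ^\<^sub>m Suc N * (A * Bc (Suc N)) = A ^\<^sub>m Suc (Suc N) * Bc (Suc N)"
      using assoc_mult_mat[OF AN A Bc] by simp
    also have "S N + (A ^\<^sub>m Suc N * Bc N - A ^\<^sub>m Suc (Suc N) * Bc (Suc N)) = - (A ^\<^sub>m Suc (Suc N) * Bc (Suc N))"
      unfolding Suc using mult_carrier_mat[OF AN Bc] mult_carrier_mat[OF pow_carrier_mat[OF A] Bc]
      by (rule alg)
    finally show ?case .
  qed
  \<comment> \<open>Large enough for two purposes: the partial sum \<open>S N\<close> contains every
    term of the characteristic polynomial, and \<open>N\<close> exceeds the degree of every entry of
    the adjugate, so that \<open>Bc N\<close> vanishes.\<close>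
  define N where "N = degree (char_poly A) + (\<Sum>a<n. \<Sum>b<n. degree (B $$ (a, b)) + 1)"
  have dB: "degree (B $$ (a, b)) < N" if "a < n" "b < n" for a b
  proof -
    have "degree (B $$ (a, b)) + 1 \<le> (\<Sum>b<n. degree (B $$ (a, b)) + 1)"
      by (rule member_le_sum[of b "{..<n}" "\<lambda>b. degree (B $$ (a, b)) + 1"]) (use that in auto)
    also have "\<dots> \<le> (\<Sum>a<n. \<Sum>b<n. degree (B $$ (a, b)) + 1)"
      by (rule member_le_sum[of a "{..<n}" "\<lambda>a. \<Sum>b<n. degree (B $$ (a, b)) + 1"]) (use that in auto)
    finally show ?thesis by (simp add: N_def)
  qed
  have "Bc N = 0\<^sub>m n n"
    using B dB by (intro eq_matI) (auto simp: Bc_def coeff_eq_0)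
  then have "S N = - (0\<^sub>m n n)"
    unfolding S by (simp only: right_mult_zero_mat[OF pow_carrier_mat[OF A]])
  also have "- (0\<^sub>m n n) = (0\<^sub>m n n :: complex mat)" by (intro eq_matI) auto
  finally have "S N = 0\<^sub>m n n" .
  moreover have "poly_of_mat (char_poly A) A = S N"
    using A index_poly_of_mat[OF A, of _ _ "char_poly A" N]
    by (intro eq_matI) (auto simp: S_def N_def poly_of_mat_def[of _ A])
  ultimately show ?thesis by simp
qed

section \<open>Rank growth under polynomials in a Sylvester equation\<close>

text \<open>The factor may be constant (\<open>d = 0\<close>). Hence \<open>P\<close> and
  \<open>Q\<close> can lose a factor simultaneously even when their degrees differ, and only the
  common bound \<open>l\<close> has to decrease.\<close>

lemma poly_split_linear:
  fixes P :: "complex poly"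
  assumes "degree P \<le> Suc l"
  obtains c d P' where "degree P' \<le> l" "P = [:c, d:] * P'"
proof (cases "degree P = 0")
  case True
  then have "degree P \<le> l" by simp
  moreover have "P = [:1, 0:] * P" by simp
  ultimately show thesis by (rule that)
next
  case False
  then have "\<not> constant (poly P)" by (simp add: constant_degree)
  then have "\<exists>z. poly P z = 0" by (rule Fundamental_Theorem_Algebra.fundamental_theorem_of_algebra)
  then obtain z where "[:-z, 1:] dvd P" by (auto simp: poly_eq_0_iff_dvd)
  then obtain P' where P': "P = [:-z, 1:] * P'" by (rule dvdE)
  have "P' \<noteq> 0"
  proof
    assume "P' = 0"
    then have "P = 0" using P' by (simp only: mult_zero_right)
    then show False using False by simp
  qed
  then have "degree ([:-z, 1:] * P') = Suc (degree P')" by (subst degree_mult_eq) auto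
  then have "degree P = Suc (degree P')" by (simp only: P'[symmetric])
  with assms show thesis by (intro that[OF _ P']) simp
qed

lemma sandwich_diff:
  assumes c: "L \<in> carrier_mat m m" "M \<in> carrier_mat m m" "M' \<in> carrier_mat m m"
    "Y \<in> carrier_mat m p" "N \<in> carrier_mat p p" "N' \<in> carrier_mat p p" "R \<in> carrier_mat p p"
  shows "L * (M * Y * N - M' * Y * N') * R
    = (L * M) * Y * (N * R) - (L * M') * Y * (N' * (R :: 'a :: comm_ring_1 mat))"
proof -
  note 1 = mult_carrier_mat[OF mult_carrier_mat[OF c(2,4)] c(5)] mult_carrier_mat[OF mult_carrier_mat[OF c(3,4)] c(6)]
  note 2 = mult_carrier_mat[OF c(1) 1(1)] mult_carrier_mat[OF c(1) 1(2)]
  have 3: "L * (M * Y * N) * R = (L * M) * Y * (N * R)"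
    if "M \<in> carrier_mat m m" "N \<in> carrier_mat p p" for M N
  proof -
    have i: "M * Y \<in> carrier_mat m p" "L * M * Y \<in> carrier_mat m p"
      using mult_carrier_mat[OF that(1) c(4)] mult_carrier_mat[OF mult_carrier_mat[OF c(1) that(1)] c(4)] .
    have "L * (M * Y * N) = (L * (M * Y)) * N"
      by (rule assoc_mult_mat[OF c(1) i(1) that(2), symmetric])
    also have "L * (M * Y) = L * M * Y" by (rule assoc_mult_mat[OF c(1) that(1) c(4), symmetric])
    finally show ?thesis by (simp only: assoc_mult_mat[OF i(2) that(2) c(7)])
  qed
  show ?thesis
    unfolding mult_minus_distrib_mat[OF c(1) 1] minus_mult_distrib_mat[OF 2 c(7)] 3[OF c(2,5)] 3[OF c(3,6)] ..
qed

text \<open>The terms in \<open>Y\<close> and \<open>A * Y * D\<close> are symmetric under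
  exchanging the two linear polynomials and cancel. The mixed terms combine to the determinant of
  the coefficients times the Sylvester operator applied to \<open>Y\<close>.\<close>

lemma linear_sylvester_exchange:
  fixes A D Y :: "'a :: comm_ring_1 mat"
  assumes A: "A \<in> carrier_mat m m" and D: "D \<in> carrier_mat p p" and Y: "Y \<in> carrier_mat m p"
  shows "(c \<cdot>\<^sub>m 1\<^sub>m m + d \<cdot>\<^sub>m A) * Y * (c' \<cdot>\<^sub>m 1\<^sub>m p + d' \<cdot>\<^sub>m D)
       - (c' \<cdot>\<^sub>m 1\<^sub>m m + d' \<cdot>\<^sub>m A) * Y * (c \<cdot>\<^sub>m 1\<^sub>m p + d \<cdot>\<^sub>m D)
     = (d * c' - c * d') \<cdot>\<^sub>m (A * Y - Y * D)"
proof -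
  have AY: "A * Y \<in> carrier_mat m p" and YD: "Y * D \<in> carrier_mat m p"
    and AYD: "A * Y * D \<in> carrier_mat m p"
    using mult_carrier_mat[OF A Y] mult_carrier_mat[OF Y D] mult_carrier_mat[OF mult_carrier_mat[OF A Y] D] .
  have *: "(c \<cdot>\<^sub>m 1\<^sub>m m + d \<cdot>\<^sub>m A) * Y * (c' \<cdot>\<^sub>m 1\<^sub>m p + d' \<cdot>\<^sub>m D)
     = (c * c') \<cdot>\<^sub>m Y + (c * d') \<cdot>\<^sub>m (Y * D) + (d * c') \<cdot>\<^sub>m (A * Y) + (d * d') \<cdot>\<^sub>m (A * Y * D)" for c d c' d'
  proof -
    have "(c \<cdot>\<^sub>m 1\<^sub>m m + d \<cdot>\<^sub>m A) * Y = (c \<cdot>\<^sub>m 1\<^sub>m m) * Y + (d \<cdot>\<^sub>m A) * Y"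
      by (rule add_mult_distrib_mat[of _ m m]) (use A Y in auto)
    also have "(c \<cdot>\<^sub>m 1\<^sub>m m) * Y = c \<cdot>\<^sub>m Y"
      using mult_smult_assoc_mat[OF one_carrier_mat Y, of c] Y by simp
    also have "(d \<cdot>\<^sub>m A) * Y = d \<cdot>\<^sub>m (A * Y)" by (rule mult_smult_assoc_mat[OF A Y])
    finally have 1: "(c \<cdot>\<^sub>m 1\<^sub>m m + d \<cdot>\<^sub>m A) * Y = c \<cdot>\<^sub>m Y + d \<cdot>\<^sub>m (A * Y)" .
    have 2: "Z * (c' \<cdot>\<^sub>m 1\<^sub>m p + d' \<cdot>\<^sub>m D) = c' \<cdot>\<^sub>m Z + d' \<cdot>\<^sub>m (Z * D)" if Z: "Z \<in> carrier_mat m p" for Z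
    proof -
      have "Z * (c' \<cdot>\<^sub>m 1\<^sub>m p + d' \<cdot>\<^sub>m D) = Z * (c' \<cdot>\<^sub>m 1\<^sub>m p) + Z * (d' \<cdot>\<^sub>m D)"
        by (rule mult_add_distrib_mat[of _ m p]) (use D Z in auto)
      then show ?thesis
        using mult_smult_distrib[OF Z one_carrier_mat, of c'] mult_smult_distrib[OF Z D, of d'] Z by simp
    qed
    have "(c \<cdot>\<^sub>m Y + d \<cdot>\<^sub>m (A * Y)) * D = c \<cdot>\<^sub>m Y * D + d \<cdot>\<^sub>m (A * Y) * D"
      by (rule add_mult_distrib_mat[of _ m p]) (use Y AY D in auto)
    also have "\<dots> = c \<cdot>\<^sub>m (Y * D) + d \<cdot>\<^sub>m (A * Y * D)"
      using mult_smult_assoc_mat[OF Y D] mult_smult_assoc_mat[OF AY D] by simp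
    finally have 3: "(c \<cdot>\<^sub>m Y + d \<cdot>\<^sub>m (A * Y)) * D = c \<cdot>\<^sub>m (Y * D) + d \<cdot>\<^sub>m (A * Y * D)" .
    have 4: "c \<cdot>\<^sub>m Y + d \<cdot>\<^sub>m (A * Y) \<in> carrier_mat m p" using Y AY by simp
    show ?thesis
      unfolding 1 2[OF 4] 3
      by (intro eq_matI) (use Y AY YD AYD in \<open>auto simp del: index_mult_mat simp: ring_distribs\<close>)
  qed
  show ?thesis
    unfolding * by (intro eq_matI)
      (use Y AY YD AYD in \<open>auto simp del: index_mult_mat simp: ring_distribs left_diff_distrib right_diff_distrib\<close>)
qed

text \<open>Splitting a linear factor off \<open>P\<close> and off \<open>Q\<close> at the same time costs one multiple of
  \<open>A Y - Y D\<close>, so each degree adds only \<open>k\<close> to the rank.\<close>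

lemma rank_le_poly_sylvester:
  fixes A D Y :: "complex mat"
  assumes A: "A \<in> carrier_mat m m" and D: "D \<in> carrier_mat p p" and Y: "Y \<in> carrier_mat m p"
    and G: "rank_le k (A * Y - Y * D)"
    and "degree P \<le> l" "degree Q \<le> l"
  shows "rank_le (k * l) (poly_of_mat P A * Y * poly_of_mat Q D - poly_of_mat Q A * Y * poly_of_mat P D)"
  using assms(5,6)
proof (induct l arbitrary: P Q)
  case 0
  then obtain a b where PQ: "P = [:a:]" "Q = [:b:]" by (auto elim!: degree_eq_zeroE)
  \<comment> \<open>Constants are linear polynomials with vanishing slope, so the determinant in the
    exchange identity is 0.\<close>
  have "poly_of_mat P A * Y * poly_of_mat Q D - poly_of_mat Q A * Y * poly_of_mat P D
      = (0 * b - a * 0) \<cdot>\<^sub>m (A * Y - Y * D)"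
    using linear_sylvester_exchange[OF A D Y, of a 0 b 0] poly_of_mat_linear[OF A, of _ 0]
      poly_of_mat_linear[OF D, of _ 0]
    unfolding PQ by simp
  also have "\<dots> = 0\<^sub>m m p" using A D Y by (intro eq_matI) auto
  finally show ?case by (simp add: rank_le_zero)
next
  case (Suc l)
  obtain c d P' where P': "degree P' \<le> l" and P: "P = [:c, d:] * P'"
    using poly_split_linear[OF Suc.prems(1)] .
  obtain c' d' Q' where Q': "degree Q' \<le> l" and Q: "Q = [:c', d':] * Q'"
    using poly_split_linear[OF Suc.prems(2)] .
  have cA: "poly_of_mat r A \<in> carrier_mat m m" and cD: "poly_of_mat r D \<in> carrier_mat p p" for r
    using A D by auto
  define S where "S r s = poly_of_mat r A * Y * poly_of_mat s D" for r s
  have S: "S r s \<in> carrier_mat m p" for r s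
    unfolding S_def by (rule mult_carrier_mat[OF mult_carrier_mat[OF cA Y] cD])
  have sand: "poly_of_mat r A * (S t u - S v w) * poly_of_mat s D = S (r * t) (u * s) - S (r * v) (w * s)"
    for r s t u v w
    unfolding S_def using sandwich_diff[OF cA cA cA Y cD cD cD]
    by (simp add: poly_of_mat_mult[OF A] poly_of_mat_mult[OF D])
  let ?u = "[:c, d:]" and ?v = "[:c', d':]"
  \<comment> \<open>Inserting the mixed term \<open>S (?v * P') (?u * Q')\<close> splits the
    exchange in two: the first bracket exchanges only the linear factors and costs rank
    \<open>k\<close>, the second exchanges only \<open>P'\<close> and \<open>Q'\<close> and falls
    under the induction hypothesis.\<close>
  have "S P Q - S Q P = (S (P' * ?u) (?v * Q') - S (P' * ?v) (?u * Q'))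
      + (S (?v * P') (Q' * ?u) - S (?v * Q') (P' * ?u))"
    unfolding P Q mult.commute[of P'] mult.commute[of Q']
    by (intro eq_matI) (use S in \<open>auto simp: carrier_matD[OF S]\<close>)
  also have "\<dots> = poly_of_mat P' A * (S ?u ?v - S ?v ?u) * poly_of_mat Q' D
      + poly_of_mat ?v A * (S P' Q' - S Q' P') * poly_of_mat ?u D"
    unfolding sand ..
  finally have eq: "S P Q - S Q P = poly_of_mat P' A * (S ?u ?v - S ?v ?u) * poly_of_mat Q' D
      + poly_of_mat ?v A * (S P' Q' - S Q' P') * poly_of_mat ?u D" .
  have r1: "rank_le k (S ?u ?v - S ?v ?u)"
    unfolding S_def poly_of_mat_linear[OF A] poly_of_mat_linear[OF D] linear_sylvester_exchange[OF A D Y]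
    by (rule rank_le_smult[OF G])
  have r2: "rank_le (k * l) (S P' Q' - S Q' P')"
    unfolding S_def by (rule Suc.hyps[OF P' Q'])
  have diff: "S r s - S t u \<in> carrier_mat m p" for r s t u by (rule minus_carrier_mat[OF S])
  have mid: "poly_of_mat r A * (S s t - S u v) \<in> carrier_mat m p" for r s t u v
    by (rule mult_carrier_mat[OF cA diff])
  have "rank_le (k + k * l) (S P Q - S Q P)"
    unfolding eq
    by (intro rank_le_add[of _ m p] rank_le_mult_right[OF mid cD] rank_le_mult_left[OF cA diff] r1 r2
        mult_carrier_mat[OF mid cD])
  then show ?case unfolding S_def by simp
qed

section \<open>Unitary diagonalization of Hermitian matrices\<close>

lemma dim_mat_adjoint [simp]:
  "dim_row (mat_adjoint A) = dim_col A" "dim_col (mat_adjoint A) = dim_row A"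
  by (auto simp: mat_adjoint_def)

lemma index_mat_adjoint [simp]:
  "i < dim_col A \<Longrightarrow> j < dim_row A \<Longrightarrow> mat_adjoint A $$ (i, j) = conjugate (A $$ (j, i))"
  by (auto simp: mat_adjoint_def mat_of_rows_index)

lemma mat_adjoint_carrier [simp]: "A \<in> carrier_mat m n \<Longrightarrow> mat_adjoint A \<in> carrier_mat n m"
  by auto

lemma mat_adjoint_adjoint [simp]: "mat_adjoint (mat_adjoint A) = A"
  by (intro eq_matI) auto

lemma mat_adjoint_mult:
  fixes A B :: "complex mat"
  assumes "A \<in> carrier_mat m n" "B \<in> carrier_mat n p"
  shows "mat_adjoint (A * B) = mat_adjoint B * mat_adjoint A"
  using assms by (intro eq_matI) (auto simp: scalar_prod_def mult.commute)

lemma cscalar_prod_sum: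
  fixes v w :: "complex Matrix.vec"
  assumes "w \<in> carrier_vec n"
  shows "v \<bullet>c w = (\<Sum>i<n. v $ i * cnj (w $ i))"
  using assms by (simp add: scalar_prod_def lessThan_atLeast0)

lemma cscalar_prod_adjoint:
  fixes A :: "complex mat"
  assumes A: "A \<in> carrier_mat m n" and x: "x \<in> carrier_vec n" and y: "y \<in> carrier_vec m"
  shows "(A *\<^sub>v x) \<bullet>c y = x \<bullet>c (mat_adjoint A *\<^sub>v y)"
proof -
  have "(A *\<^sub>v x) \<bullet>c y = (\<Sum>i<m. (\<Sum>j<n. A $$ (i, j) * x $ j) * cnj (y $ i))"
    using A x unfolding cscalar_prod_sum[OF y]
    by (intro sum.cong) (auto simp: scalar_prod_def lessThan_atLeast0)
  also have "\<dots> = (\<Sum>j<n. \<Sum>i<m. A $$ (i, j) * x $ j * cnj (y $ i))"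
    unfolding sum_distrib_right by (rule sum.swap)
  also have "\<dots> = (\<Sum>j<n. x $ j * cnj (\<Sum>i<m. mat_adjoint A $$ (j, i) * y $ i))"
    using A unfolding cnj_sum sum_distrib_left by (intro sum.cong) auto
  also have "\<dots> = x \<bullet>c (mat_adjoint A *\<^sub>v y)"
  proof -
    have "mat_adjoint A *\<^sub>v y \<in> carrier_vec n" using A by (auto intro: carrier_vecI)
    from cscalar_prod_sum[OF this] show ?thesis
      using A y by (auto simp: scalar_prod_def lessThan_atLeast0 intro!: sum.cong)
  qed
  finally show ?thesis .
qed

lemma vec_norm2_nonneg [simp]: "0 \<le> vec_norm2 v"
  by (simp add: vec_norm2_def sum_nonneg)

lemma vec_norm2_sq:
  assumes "v \<in> carrier_vec n"
  shows "(vec_norm2 v)\<^sup>2 = (\<Sum>i<n. (cmod (v $ i))\<^sup>2)"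
  using assms by (simp add: vec_norm2_def sum_nonneg)

lemma cscalar_prod_self:
  fixes v :: "complex Matrix.vec"
  shows "v \<bullet>c v = of_real ((vec_norm2 v)\<^sup>2)"
  unfolding vec_norm2_sq[OF carrier_vec_dim_vec] cscalar_prod_sum[OF carrier_vec_dim_vec]
  by (simp only: of_real_sum complex_norm_square)

lemma vec_norm2_eq_0_iff:
  assumes "v \<in> carrier_vec n"
  shows "vec_norm2 v = 0 \<longleftrightarrow> v = 0\<^sub>v n"
  using conjugate_square_eq_0_vec[OF assms] by (simp add: cscalar_prod_self)

lemma vec_norm2_smult: "vec_norm2 (c \<cdot>\<^sub>v v) = cmod c * vec_norm2 v"
  by (simp add: vec_norm2_def norm_mult power_mult_distrib real_sqrt_mult flip: sum_distrib_left)

section \<open>Unitary matrices\<close>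

definition unitary :: "nat \<Rightarrow> complex mat \<Rightarrow> bool" where
  "unitary n W \<longleftrightarrow> W \<in> carrier_mat n n \<and> mat_adjoint W * W = 1\<^sub>m n"

lemma unitary_carrier: "unitary n W \<Longrightarrow> W \<in> carrier_mat n n"
  by (simp add: unitary_def)

lemma unitary_right: "unitary n W \<Longrightarrow> W * mat_adjoint W = 1\<^sub>m n"
  unfolding unitary_def by (metis mat_adjoint_carrier mat_mult_left_right_inverse)

lemma unitary_mult:
  assumes U: "unitary n U" and V: "unitary n V"
  shows "unitary n (U * V)"
proof -
  note c = unitary_carrier[OF U] unitary_carrier[OF V]
  have "mat_adjoint (U * V) * (U * V) = mat_adjoint V * ((mat_adjoint U * U) * V)"
    unfolding mat_adjoint_mult[OF c] using c
    by (simp add: assoc_mult_mat[of _ n n _ n _ n])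
  also have "\<dots> = 1\<^sub>m n" using U V c by (simp add: unitary_def)
  finally show ?thesis using c by (simp add: unitary_def)
qed

lemma unitary_norm:
  assumes W: "unitary n W" and x: "x \<in> carrier_vec n"
  shows "vec_norm2 (W *\<^sub>v x) = vec_norm2 x"
proof -
  note c = unitary_carrier[OF W]
  have Wx: "W *\<^sub>v x \<in> carrier_vec n" using c x by simp
  have "(W *\<^sub>v x) \<bullet>c (W *\<^sub>v x) = x \<bullet>c (mat_adjoint W *\<^sub>v (W *\<^sub>v x))"
    by (rule cscalar_prod_adjoint[OF c x Wx])
  also have "mat_adjoint W *\<^sub>v (W *\<^sub>v x) = (mat_adjoint W * W) *\<^sub>v x"
    using assoc_mult_mat_vec[OF mat_adjoint_carrier[OF c] c x] by simp
  also have "\<dots> = x" using W x by (simp add: unitary_def)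
  finally have "(vec_norm2 (W *\<^sub>v x))\<^sup>2 = (vec_norm2 x)\<^sup>2"
    unfolding cscalar_prod_self of_real_eq_iff .
  then show ?thesis by simp
qed

text \<open>Gram-Schmidt applied to a basis that starts with \<open>v\<close> keeps \<open>v\<close>
  in first place. Its output is orthogonal but not normalized, so each vector is divided by its
  length; this is the origin of the scalar \<open>c\<close>.\<close>

lemma unitary_completion:
  fixes v :: "complex Matrix.vec"
  assumes v: "v \<in> carrier_vec n" and v0: "v \<noteq> 0\<^sub>v n" and n: "0 < n"
  obtains W c where "unitary n W" "col W 0 = c \<cdot>\<^sub>v v" "c \<noteq> 0"
proof -
  interpret cof_vec_space n "TYPE(complex)" .
  define ws where "ws = gram_schmidt n (basis_completion v)"
  note bc = basis_completion[OF v v0]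
  have ws: "set ws \<subseteq> carrier_vec n" "corthogonal ws" "length ws = n"
    using gram_schmidt_result[OF bc(2,4,5) ws_def] bc(6) by auto
  obtain vs where "basis_completion v = v # vs"
    using bc(6,7) n by (cases "basis_completion v") auto
  then have hd: "ws ! 0 = v"
    using gram_schmidt_hd[OF v, of vs] ws(3) n hd_conv_nth[of ws] unfolding ws_def by fastforce
  define s where "s w = complex_of_real (1 / vec_norm2 w)" for w
  define W where "W = mat_of_cols n (map (\<lambda>w. s w \<cdot>\<^sub>v w) ws)"
  have W: "W \<in> carrier_mat n n" using ws(3) by (auto simp: W_def)
  have wsi: "ws ! i \<in> carrier_vec n" if "i < n" for i using ws that by auto
  have colW: "col W i = s (ws ! i) \<cdot>\<^sub>v (ws ! i)" if "i < n" for i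
    unfolding W_def using ws that wsi[OF that] by (subst col_mat_of_cols) auto
  have ortho: "ws ! i \<bullet>c ws ! j = (if i = j then of_real ((vec_norm2 (ws ! i))\<^sup>2) else 0)"
    if "i < n" "j < n" for i j
    using corthogonalD[OF ws(2), of i j] that ws(3) cscalar_prod_self by auto
  have pos: "vec_norm2 (ws ! i) \<noteq> 0" if "i < n" for i
    using corthogonalD[OF ws(2), of i i] that ws(3) by (auto simp: cscalar_prod_self)
  have "mat_adjoint W * W = 1\<^sub>m n"
  proof (rule eq_matI)
    fix i j assume "i < dim_row (1\<^sub>m n :: complex mat)" "j < dim_col (1\<^sub>m n :: complex mat)"
    then have ij: "i < n" "j < n" by auto
    have ci: "col W i \<in> carrier_vec n" using W ij by auto
    have "(mat_adjoint W * W) $$ (i, j) = (\<Sum>k<n. cnj (W $$ (k, i)) * W $$ (k, j))"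
      using W ij by (simp add: scalar_prod_def lessThan_atLeast0)
    also have "\<dots> = col W j \<bullet>c col W i"
      unfolding cscalar_prod_sum[OF ci] using W ij by (intro sum.cong) (auto simp: mult.commute)
    also have "\<dots> = s (ws ! j) * cnj (s (ws ! i)) * (ws ! j \<bullet>c ws ! i)"
      unfolding colW[OF ij(1)] colW[OF ij(2)] using wsi[OF ij(1)] wsi[OF ij(2)]
      by (simp add: scalar_prod_def sum_distrib_left mult_ac)
    also have "\<dots> = 1\<^sub>m n $$ (i, j)"
      unfolding ortho[OF ij(2,1)] using ij pos[OF ij(1)] by (auto simp: s_def power2_eq_square)
    finally show "(mat_adjoint W * W) $$ (i, j) = 1\<^sub>m n $$ (i, j)" .
  qed (use W in auto)
  then have "unitary n W" using W by (simp add: unitary_def)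
  moreover have "col W 0 = s v \<cdot>\<^sub>v v" using colW[OF n] hd by simp
  moreover have "s v \<noteq> 0" using pos[OF n] hd by (simp add: s_def)
  ultimately show thesis by (rule that)
qed

lemma mat_adjoint_four_block:
  fixes A B C D :: "complex mat"
  assumes "A \<in> carrier_mat a a'" "B \<in> carrier_mat a b'" "C \<in> carrier_mat b a'" "D \<in> carrier_mat b b'"
  shows "mat_adjoint (four_block_mat A B C D)
    = four_block_mat (mat_adjoint A) (mat_adjoint C) (mat_adjoint B) (mat_adjoint D)"
  using assms by (intro eq_matI) auto

text \<open>Deflation by induction on the dimension. A unitary \<open>W\<close> whose first column
  is an eigenvector makes the first column of the conjugated matrix a multiple of a unit vector;
  Hermitian symmetry clears the first row as well and leaves a smaller Hermitian block
  \<open>N\<close>.\<close>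

theorem hermitian_diagonalization:
  assumes "M \<in> carrier_mat n n" "mat_adjoint M = M"
  obtains P d where "unitary n P" "mat_adjoint P * M * P = mat_diag n (\<lambda>i. complex_of_real (d i))"
  using assms
proof (induct n arbitrary: M thesis)
  case 0
  have "unitary 0 (1\<^sub>m 0)" by (simp add: unitary_def mat_eq_iff)
  moreover have "mat_adjoint (1\<^sub>m 0) * M * 1\<^sub>m 0 = mat_diag 0 (\<lambda>i. complex_of_real 0)"
    using "0.prems" by (intro eq_matI) (auto simp: mat_diag_def)
  ultimately show ?case by (rule "0.prems"(1))
next
  case (Suc n)
  note M = Suc.prems(2) and H = Suc.prems(3)
  obtain as where as: "char_poly M = (\<Prod>a\<leftarrow>as. [:- a, 1:])" "length as = Suc n"
    using char_poly_factorized[OF M] by auto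
  then obtain a where "a \<in> set as" by (cases as) auto
  then have "poly (char_poly M) a = 0" unfolding as poly_prod_list by (auto simp: prod_list_zero_iff)
  then have "eigenvalue M a" by (simp add: eigenvalue_root_char_poly[OF M])
  then obtain v where v: "v \<in> carrier_vec (Suc n)" "v \<noteq> 0\<^sub>v (Suc n)" "M *\<^sub>v v = a \<cdot>\<^sub>v v"
    using M by (auto simp: eigenvalue_def eigenvector_def)
  obtain W c where W: "unitary (Suc n) W" and W0: "col W 0 = c \<cdot>\<^sub>v v"
    using unitary_completion[OF v(1,2)] by blast
  note cW = unitary_carrier[OF W]
  note cW' = mat_adjoint_carrier[OF cW]
  define M' where "M' = mat_adjoint W * M * W"
  have cM': "M' \<in> carrier_mat (Suc n) (Suc n)"
    unfolding M'_def using mult_carrier_mat[OF mult_carrier_mat[OF cW' M] cW] .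
  have M'_assoc: "M' = mat_adjoint W * (M * W)"
    unfolding M'_def by (rule assoc_mult_mat[OF cW' M cW])
  have H': "mat_adjoint M' = M'"
    unfolding M'_def mat_adjoint_mult[OF mult_carrier_mat[OF cW' M] cW] mat_adjoint_mult[OF cW' M] H mat_adjoint_adjoint
    by (rule assoc_mult_mat[OF cW' M cW, symmetric])
  have "col M' 0 = mat_adjoint W *\<^sub>v col (M * W) 0"
    unfolding M'_assoc by (rule col_mult2[OF cW' mult_carrier_mat[OF M cW]]) simp
  also have "col (M * W) 0 = M *\<^sub>v col W 0" by (rule col_mult2[OF M cW]) simp
  also have "\<dots> = c \<cdot>\<^sub>v (M *\<^sub>v v)" unfolding W0 by (rule mult_mat_vec[OF M v(1)])
  also have "\<dots> = a \<cdot>\<^sub>v col W 0" unfolding W0 v(3) by (simp add: smult_smult_assoc mult.commute)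
  also have "mat_adjoint W *\<^sub>v (a \<cdot>\<^sub>v col W 0) = a \<cdot>\<^sub>v (mat_adjoint W *\<^sub>v col W 0)"
    by (rule mult_mat_vec[OF cW' col_carrier_vec[OF _ cW]]) simp
  also have "mat_adjoint W *\<^sub>v col W 0 = col (mat_adjoint W * W) 0"
    by (rule col_mult2[OF cW' cW, symmetric]) simp
  also have "mat_adjoint W * W = 1\<^sub>m (Suc n)" using W by (simp add: unitary_def)
  finally have col0: "col M' 0 = a \<cdot>\<^sub>v unit_vec (Suc n) 0" by simp
  have e0: "M' $$ (i, 0) = (if i = 0 then a else 0)" if "i < Suc n" for i
    using arg_cong[OF col0, of "\<lambda>v. v $ i"] that cM' by (auto simp: unit_vec_def)
  have herm: "M' $$ (i, j) = cnj (M' $$ (j, i))" if "i < Suc n" "j < Suc n" for i j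
    using arg_cong[OF H', of "\<lambda>X. X $$ (i, j)"] that cM' by simp
  have e0': "M' $$ (0, i) = (if i = 0 then a else 0)" if "i < Suc n" for i
    using herm[of 0 i] e0[of i] e0[of 0] that by (auto split: if_splits)
  \<comment> \<open>A diagonal entry of a Hermitian matrix equals its own conjugate.\<close>
  have areal: "a = complex_of_real (Re a)"
    using herm[of 0 0] e0[of 0] by (simp add: complex_eq_iff)
  define N where "N = Matrix.mat n n (\<lambda>(i, j). M' $$ (Suc i, Suc j))"
  have N: "N \<in> carrier_mat n n" by (simp add: N_def)
  have HN: "mat_adjoint N = N"
    by (intro eq_matI) (auto simp: N_def herm[symmetric])
  obtain Q d where Q: "unitary n Q" and d: "mat_adjoint Q * N * Q = mat_diag n (\<lambda>i. complex_of_real (d i))"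
    using Suc.hyps[OF _ N HN] by blast
  note cQ = unitary_carrier[OF Q]
  note cQ' = mat_adjoint_carrier[OF cQ]
  let ?a = "a \<cdot>\<^sub>m 1\<^sub>m 1 :: complex mat"
  let ?O1 = "0\<^sub>m 1 n :: complex mat" and ?O2 = "0\<^sub>m n 1 :: complex mat"
  have ca: "?a \<in> carrier_mat 1 1" by simp
  have M'_block: "M' = four_block_mat ?a ?O1 ?O2 N"
    using cM' e0 e0' by (intro eq_matI) (auto simp: N_def)
  define R where "R = four_block_mat (1\<^sub>m 1) ?O1 ?O2 Q"
  have cR: "R \<in> carrier_mat (Suc n) (Suc n)"
    unfolding R_def using four_block_carrier_mat[of "1\<^sub>m 1" 1 1 Q n n] cQ by auto
  have adj1: "mat_adjoint (1\<^sub>m 1 :: complex mat) = 1\<^sub>m 1" "mat_adjoint ?O1 = ?O2" "mat_adjoint ?O2 = ?O1"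
    by (intro eq_matI; auto)+
  have R': "mat_adjoint R = four_block_mat (1\<^sub>m 1) ?O1 ?O2 (mat_adjoint Q)"
    unfolding R_def by (subst mat_adjoint_four_block[of _ 1 1 _ n _ n]) (use cQ adj1 in auto)
  have prod: "four_block_mat x ?O1 ?O2 X * four_block_mat y ?O1 ?O2 Z = four_block_mat (x * y) ?O1 ?O2 (X * Z)"
    if "x \<in> carrier_mat 1 1" "y \<in> carrier_mat 1 1" "X \<in> carrier_mat n n" "Z \<in> carrier_mat n n" for x y X Z
  proof -
    have "four_block_mat x ?O1 ?O2 X * four_block_mat y ?O1 ?O2 Z
      = four_block_mat (x * y + ?O1 * ?O2) (x * ?O1 + ?O1 * Z) (?O2 * y + X * ?O2) (?O2 * ?O1 + X * Z)"
      by (rule mult_four_block_mat[OF that(1) _ _ that(3) that(2) _ _ that(4)]) auto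
    also have "\<dots> = four_block_mat (x * y) ?O1 ?O2 (X * Z)"
      using that by (intro cong_four_block_mat) (auto intro!: eq_matI)
    finally show ?thesis .
  qed
  have one: "four_block_mat (1\<^sub>m 1) ?O1 ?O2 (1\<^sub>m n) = 1\<^sub>m (Suc n)"
    by (intro eq_matI) auto
  have "mat_adjoint R * R = 1\<^sub>m (Suc n)"
    unfolding R' unfolding R_def
    by (subst prod) (use cQ Q one in \<open>auto simp: unitary_def\<close>)
  then have uR: "unitary (Suc n) R" using cR by (simp add: unitary_def)
  have "mat_adjoint (W * R) * M * (W * R) = mat_adjoint R * M' * R"
  proof -
    note cR' = mat_adjoint_carrier[OF cR]
    have "mat_adjoint (W * R) * M * (W * R) = (mat_adjoint R * mat_adjoint W) * M * (W * R)"
      by (simp add: mat_adjoint_mult[OF cW cR])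
    also have "(mat_adjoint R * mat_adjoint W) * M = mat_adjoint R * (mat_adjoint W * M)"
      by (rule assoc_mult_mat[OF cR' cW' M])
    also have "\<dots> * (W * R) = mat_adjoint R * (mat_adjoint W * M) * W * R"
      by (rule assoc_mult_mat[symmetric, OF mult_carrier_mat[OF cR' mult_carrier_mat[OF cW' M]] cW cR])
    also have "mat_adjoint R * (mat_adjoint W * M) * W = mat_adjoint R * (mat_adjoint W * M * W)"
      by (rule assoc_mult_mat[OF cR' mult_carrier_mat[OF cW' M] cW])
    finally show ?thesis by (simp add: M'_def)
  qed
  also have "\<dots> = four_block_mat (1\<^sub>m 1 * ?a * 1\<^sub>m 1) ?O1 ?O2 (mat_adjoint Q * N * Q)"
    unfolding R' M'_block unfolding R_def prod[OF one_carrier_mat ca cQ' N]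
    by (rule prod[OF mult_carrier_mat[OF one_carrier_mat ca] one_carrier_mat mult_carrier_mat[OF cQ' N] cQ])
  also have "\<dots> = four_block_mat ?a ?O1 ?O2 (mat_adjoint Q * N * Q)"
    unfolding left_mult_one_mat[OF ca] right_mult_one_mat[OF ca] ..
  also have "\<dots> = mat_diag (Suc n) (\<lambda>i. complex_of_real (case i of 0 \<Rightarrow> Re a | Suc j \<Rightarrow> d j))"
    unfolding d using areal by (intro eq_matI) (auto simp: mat_diag_def split: nat.splits)
  finally show ?case using Suc.prems(1) unitary_mult[OF W uR] by blast
qed

section \<open>Singular values\<close>

text \<open>Padding \<open>V\<close> with zero rows to a square matrix does not change the kernel.
  Because \<open>r < s\<close>, row \<open>r\<close> of the padded matrix exists and is zero, so its
  determinant vanishes.\<close>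

lemma wide_system_kernel:
  fixes V :: "'a :: field mat"
  assumes V: "V \<in> carrier_mat r s" and rs: "r < s"
  obtains y where "y \<in> carrier_vec s" "y \<noteq> 0\<^sub>v s" "V *\<^sub>v y = 0\<^sub>v r"
proof -
  let ?M = "mat\<^sub>r s s (\<lambda>i. if i = r then 0\<^sub>v s else if i < r then row V i else 0\<^sub>v s)"
  have M: "?M \<in> carrier_mat s s" by simp
  have "Determinant.det ?M = 0"
    by (rule Determinant.det_row_0[OF rs]) (use V in auto)
  then obtain y where y: "y \<in> carrier_vec s" "y \<noteq> 0\<^sub>v s" "?M *\<^sub>v y = 0\<^sub>v s"
    using det_0_iff_vec_prod_zero_field[OF M] by auto
  have "V *\<^sub>v y = 0\<^sub>v r"
  proof (rule eq_vecI)
    fix i assume "i < dim_vec (0\<^sub>v r :: 'a Matrix.vec)"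
    then have i: "i < r" by simp
    have "row ?M i = row V i" using i V rs by (subst row_mat_of_row_fun) auto
    then show "(V *\<^sub>v y) $ i = 0\<^sub>v r $ i"
      using arg_cong[OF y(3), of "\<lambda>v. v $ i"] i V rs by simp
  qed (use V in auto)
  with y(1,2) show thesis by (rule that)
qed

text \<open>Restrict \<open>V\<close> to the columns in \<open>J\<close>, take a kernel vector of
  this wide system and extend it by 0. It provides the test vector for Eckart-Young, with
  \<open>J\<close> selecting the directions of large singular values.\<close>

lemma supported_kernel_vector:
  fixes V :: "'a :: field mat"
  assumes V: "V \<in> carrier_mat r p" and J: "J \<subseteq> {..<p}" "r < card J"
  obtains y where "y \<in> carrier_vec p" "y \<noteq> 0\<^sub>v p" "V *\<^sub>v y = 0\<^sub>v r" "\<And>i. i < p \<Longrightarrow> i \<notin> J \<Longrightarrow> y $ i = 0"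
proof -
  have fin: "finite J" using J(1) finite_subset by blast
  obtain f where f: "bij_betw f {..<card J} J"
    using ex_bij_betw_nat_finite[OF fin] by (auto simp: lessThan_atLeast0)
  let ?V = "Matrix.mat r (card J) (\<lambda>(i, j). V $$ (i, f j))"
  obtain z where z: "z \<in> carrier_vec (card J)" "z \<noteq> 0\<^sub>v (card J)" "?V *\<^sub>v z = 0\<^sub>v r"
    using wide_system_kernel[OF _ J(2), of ?V] by auto
  define y where "y = Matrix.vec p (\<lambda>i. if i \<in> J then z $ (the_inv_into {..<card J} f i) else 0)"
  have fJ: "f j \<in> J" "f j < p" "the_inv_into {..<card J} f (f j) = j" if "j < card J" for j
    using f J(1) that by (auto simp: bij_betw_def the_inv_into_f_f)
  have yf: "y $ f j = z $ j" if "j < card J" for j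
    using fJ[OF that] by (simp add: y_def)
  have "y \<noteq> 0\<^sub>v p"
  proof
    assume y0: "y = 0\<^sub>v p"
    have "z = 0\<^sub>v (card J)"
    proof (rule eq_vecI)
      fix j assume "j < dim_vec (0\<^sub>v (card J) :: 'a Matrix.vec)"
      then have "j < card J" by simp
      from yf[OF this] fJ[OF this] this show "z $ j = 0\<^sub>v (card J) $ j" by (simp add: y0)
    qed (use z in auto)
    then show False using z(2) by simp
  qed
  moreover have "V *\<^sub>v y = 0\<^sub>v r"
  proof (rule eq_vecI)
    fix i assume "i < dim_vec (0\<^sub>v r :: 'a Matrix.vec)"
    then have i: "i < r" by simp
    have "(V *\<^sub>v y) $ i = (\<Sum>j<p. V $$ (i, j) * y $ j)"
      using i V by (simp add: scalar_prod_def lessThan_atLeast0 y_def)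
    also have "\<dots> = (\<Sum>j\<in>J. V $$ (i, j) * y $ j)"
      using J(1) by (intro sum.mono_neutral_right) (auto simp: y_def)
    also have "\<dots> = (\<Sum>j<card J. V $$ (i, f j) * z $ j)"
      using sum.reindex_bij_betw[OF f, of "\<lambda>j. V $$ (i, j) * y $ j"] yf by simp
    also have "\<dots> = (?V *\<^sub>v z) $ i"
      using i z(1) by (simp add: scalar_prod_def lessThan_atLeast0)
    finally show "(V *\<^sub>v y) $ i = 0\<^sub>v r $ i" using z(3) by simp
  qed (use V in auto)
  ultimately show thesis using that[of y] by (auto simp: y_def)
qed

text \<open>Turns a position in the sorted list into a count of indices of the unsorted one: the
  first \<open>r + 1\<close> entries in descending order are all at least the entry at position
  \<open>r\<close>, and sorting preserves how many entries pass that test.\<close>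

lemma card_ge_nth_rev_sort:
  fixes xs :: "'a :: linorder list"
  assumes "r < length xs"
  shows "r < card {i. i < length xs \<and> rev (sort xs) ! r \<le> xs ! i}"
proof -
  let ?ys = "rev (sort xs)" and ?P = "\<lambda>x. rev (sort xs) ! r \<le> x"
  have "\<forall>x \<in> set (take (Suc r) ?ys). ?P x"
  proof
    fix x assume "x \<in> set (take (Suc r) ?ys)"
    then obtain j where j: "j \<le> r" "j < length xs" "x = ?ys ! j"
      by (auto simp: in_set_conv_nth less_Suc_eq_le)
    have "sort xs ! (length xs - Suc r) \<le> sort xs ! (length xs - Suc j)"
      by (rule sorted_nth_mono) (use j assms in auto)
    then show "?P x" using j assms by (simp add: rev_nth)
  qed
  then have "filter ?P (take (Suc r) ?ys) = take (Suc r) ?ys" by (simp add: filter_id_conv)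
  moreover have "length (filter ?P (take (Suc r) ?ys)) \<le> length (filter ?P ?ys)"
    using filter_append[of ?P "take (Suc r) ?ys" "drop (Suc r) ?ys"] by simp
  ultimately have "Suc r \<le> length (filter ?P ?ys)" using assms by (simp del: filter_eq_nths)
  also have "length (filter ?P ?ys) = length (filter ?P xs)"
    by (rule mset_eq_length) simp
  also have "\<dots> = card {i. i < length xs \<and> ?P (xs ! i)}" by (rule length_filter_conv_card)
  finally show ?thesis by simp
qed

text \<open>The columns of \<open>P\<close> are right singular vectors, obtained by diagonalizing
  the Gram matrix of \<open>Y\<close>. In these coordinates the squared length of the image is a
  weighted sum of squares, which is the form in which singular values are used from here on.\<close>

lemma singular_values_orthogonal:
  assumes Y: "Y \<in> carrier_mat m p"
  obtains P s where "unitary p P" "\<And>i. i < p \<Longrightarrow> 0 \<le> s i"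
    "\<And>y. y \<in> carrier_vec p \<Longrightarrow> (vec_norm2 (Y *\<^sub>v (P *\<^sub>v y)))\<^sup>2 = (\<Sum>i<p. (s i)\<^sup>2 * (cmod (y $ i))\<^sup>2)"
    "singular_values Y = rev (sort (map s [0..<p]))"
proof -
  let ?M = "mat_adjoint Y * Y"
  note Y' = mat_adjoint_carrier[OF Y]
  have M: "?M \<in> carrier_mat p p" by (rule mult_carrier_mat[OF Y' Y])
  have "mat_adjoint ?M = ?M" by (simp add: mat_adjoint_mult[OF Y' Y])
  then obtain P d where P: "unitary p P" and d: "mat_adjoint P * ?M * P = mat_diag p (\<lambda>i. complex_of_real (d i))"
    using hermitian_diagonalization[OF M] by blast
  note cP = unitary_carrier[OF P]
  note cP' = mat_adjoint_carrier[OF cP]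
  let ?D = "mat_diag p (\<lambda>i. complex_of_real (d i))"
  have quad: "(vec_norm2 (Y *\<^sub>v (P *\<^sub>v y)))\<^sup>2 = (\<Sum>i<p. d i * (cmod (y $ i))\<^sup>2)" if y: "y \<in> carrier_vec p" for y
  proof -
    have Py: "P *\<^sub>v y \<in> carrier_vec p" using cP y by simp
    have YPy: "Y *\<^sub>v (P *\<^sub>v y) \<in> carrier_vec m" using Y Py by simp
    have MPy: "mat_adjoint Y *\<^sub>v (Y *\<^sub>v (P *\<^sub>v y)) \<in> carrier_vec p" using Y' YPy by simp
    have "complex_of_real ((vec_norm2 (Y *\<^sub>v (P *\<^sub>v y)))\<^sup>2)
        = y \<bullet>c (mat_adjoint P *\<^sub>v (mat_adjoint Y *\<^sub>v (Y *\<^sub>v (P *\<^sub>v y))))"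
      unfolding cscalar_prod_self[symmetric] cscalar_prod_adjoint[OF Y Py YPy] by (rule cscalar_prod_adjoint[OF cP y MPy])
    also have "mat_adjoint P *\<^sub>v (mat_adjoint Y *\<^sub>v (Y *\<^sub>v (P *\<^sub>v y))) = ?D *\<^sub>v y"
      unfolding d[symmetric] assoc_mult_mat_vec[OF mult_carrier_mat[OF cP' M] cP y]
        assoc_mult_mat_vec[OF cP' M Py] assoc_mult_mat_vec[OF Y' Y Py] ..
    also have "y \<bullet>c (?D *\<^sub>v y) = complex_of_real (\<Sum>i<p. d i * (cmod (y $ i))\<^sup>2)"
    proof -
      have Dy: "?D *\<^sub>v y \<in> carrier_vec p" using y mat_diag_dim by (rule mult_mat_vec_carrier[rotated])
      have "(?D *\<^sub>v y) $ i = complex_of_real (d i) * y $ i" if i: "i < p" for i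
      proof -
        have "(?D *\<^sub>v y) $ i = (\<Sum>j<p. (if i = j then complex_of_real (d j) else 0) * y $ j)"
          using i y by (simp add: scalar_prod_def lessThan_atLeast0 mat_diag_def)
        also have "\<dots> = (\<Sum>j<p. if i = j then complex_of_real (d j) * y $ j else 0)"
          by (rule sum.cong) auto
        finally show ?thesis using i by simp
      qed
      then show ?thesis
        unfolding cscalar_prod_sum[OF Dy] of_real_sum of_real_mult complex_norm_square
        by (intro sum.cong) auto
    qed
    finally show ?thesis unfolding of_real_eq_iff .
  qed
  \<comment> \<open>The eigenvalue is the squared length of the image of the corresponding
    eigenvector.\<close>
  have d0: "0 \<le> d i" if "i < p" for i
  proof -
    have "(\<Sum>j<p. d j * (cmod (unit_vec p i $ j))\<^sup>2) = (\<Sum>j<p. if j = i then d j else 0)"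
      using that by (intro sum.cong) auto
    also have "\<dots> = d i" using that by simp
    finally have "d i = (vec_norm2 (Y *\<^sub>v (P *\<^sub>v unit_vec p i)))\<^sup>2"
      using quad[of "unit_vec p i"] by simp
    then show ?thesis by simp
  qed
  \<comment> \<open>Similarity transfers the characteristic polynomial, and with it the multiset of
    roots from which \<open>singular_values\<close> is built.\<close>
  have "similar_mat ?M ?D"
  proof (rule similar_matI)
    show "P * mat_adjoint P = 1\<^sub>m p" "mat_adjoint P * P = 1\<^sub>m p"
      using P unitary_right[OF P] by (auto simp: unitary_def)
    have "P * ?D * mat_adjoint P = (P * mat_adjoint P) * ?M * (P * mat_adjoint P)"
      unfolding d[symmetric]
      using cP cP' M by (simp add: assoc_mult_mat[of _ p p _ p _ p] mult_carrier_mat[of _ p p _ p])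
    then show "?M = P * ?D * mat_adjoint P"
      unfolding unitary_right[OF P] left_mult_one_mat[OF M] right_mult_one_mat[OF M] ..
  qed (use cP cP' M in auto)
  then have "char_poly ?M = char_poly ?D" by (rule char_poly_similar)
  also have "\<dots> = (\<Prod>a\<leftarrow>diag_mat ?D. [:- a, 1:])"
    by (rule char_poly_upper_triangular[OF mat_diag_dim]) (auto simp: mat_diag_def)
  also have "diag_mat ?D = map (\<lambda>i. complex_of_real (d i)) [0..<p]"
    by (auto simp: diag_mat_def mat_diag_def)
  finally have cp: "char_poly ?M = (\<Prod>a\<leftarrow>map (\<lambda>i. complex_of_real (d i)) [0..<p]. [:- a, 1:])" .
  have roots: "proots (\<Prod>a\<leftarrow>as. [:- a, 1:]) = mset as" for as :: "complex list"
  proof (induct as)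
    case (Cons a as)
    have "(\<Prod>a\<leftarrow>as. [:- a, 1:]) \<noteq> 0" by (auto simp: prod_list_zero_iff)
    then have "proots ([:- a, 1:] * (\<Prod>a\<leftarrow>as. [:- a, 1:])) = {#a#} + mset as"
      by (subst proots_mult) (auto simp: Cons)
    then show ?case by simp
  qed simp
  have "proots (char_poly ?M) = mset (map (\<lambda>i. complex_of_real (d i)) [0..<p])"
    unfolding cp by (rule roots)
  then have "singular_values Y = rev (sort (map (\<lambda>i. sqrt (d i)) [0..<p]))"
    unfolding singular_values_def by (simp add: comp_def flip: mset_map)
  then show thesis
    using P quad d0 by (intro that[of P "\<lambda>i. sqrt (d i)"]) auto
qed

lemma vec_norm2_mult_le_singular_value:
  assumes Y: "Y \<in> carrier_mat m p" and x: "x \<in> carrier_vec p" and "0 < m" "0 < p"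
  shows "vec_norm2 (Y *\<^sub>v x) \<le> singular_value 1 Y * vec_norm2 x"
proof -
  obtain P s where P: "unitary p P" and s: "\<And>i. i < p \<Longrightarrow> 0 \<le> s i"
    and quad: "\<And>y. y \<in> carrier_vec p \<Longrightarrow> (vec_norm2 (Y *\<^sub>v (P *\<^sub>v y)))\<^sup>2 = (\<Sum>i<p. (s i)\<^sup>2 * (cmod (y $ i))\<^sup>2)"
    and sv: "singular_values Y = rev (sort (map s [0..<p]))"
    using singular_values_orthogonal[OF Y] by blast
  let ?xs = "map s [0..<p]" and ?S = "singular_value 1 Y"
  have S: "?S = rev (sort ?xs) ! 0" using Y assms(3,4) sv by (simp add: singular_value_def)
  have le: "s i \<le> ?S" if "i < p" for i
  proof -
    have "s i \<in> set (sort ?xs)" using that by auto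
    then obtain j where j: "j < p" "s i = sort ?xs ! j" unfolding in_set_conv_nth by auto
    have "sort ?xs ! j \<le> sort ?xs ! (p - 1)" by (rule sorted_nth_mono) (use j in auto)
    then show ?thesis unfolding S using j assms(4) by (simp add: rev_nth)
  qed
  have S0: "0 \<le> ?S" using le[of 0] s[of 0] assms(4) by linarith
  let ?y = "mat_adjoint P *\<^sub>v x"
  note cP = unitary_carrier[OF P]
  have y: "?y \<in> carrier_vec p" using cP x by (auto intro: carrier_vecI)
  have Py: "P *\<^sub>v ?y = x"
    using assoc_mult_mat_vec[OF cP mat_adjoint_carrier[OF cP] x] unitary_right[OF P] x by simp
  have "(vec_norm2 (Y *\<^sub>v x))\<^sup>2 = (\<Sum>i<p. (s i)\<^sup>2 * (cmod (?y $ i))\<^sup>2)"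
    using quad[OF y] by (simp add: Py)
  also have "\<dots> \<le> (\<Sum>i<p. ?S\<^sup>2 * (cmod (?y $ i))\<^sup>2)"
    using le s by (intro sum_mono mult_right_mono power_mono) auto
  also have "\<dots> = ?S\<^sup>2 * (vec_norm2 x)\<^sup>2"
    using unitary_norm[OF P y] unfolding vec_norm2_sq[OF y, symmetric] sum_distrib_left[symmetric] Py by simp
  finally have "(vec_norm2 (Y *\<^sub>v x))\<^sup>2 \<le> (?S * vec_norm2 x)\<^sup>2" by (simp add: power_mult_distrib)
  then show ?thesis by (rule power2_le_imp_le) (rule mult_nonneg_nonneg[OF S0 vec_norm2_nonneg])
qed

text \<open>The Eckart--Young bound: the rank condition is expressed by the \<open>r\<close> linear conditions
  \<open>V x = 0\<close>.\<close>

lemma singular_value_le: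
  assumes Y: "Y \<in> carrier_mat m p" and V: "V \<in> carrier_mat r p"
    and bound: "\<And>x. x \<in> carrier_vec p \<Longrightarrow> V *\<^sub>v x = 0\<^sub>v r \<Longrightarrow> vec_norm2 (Y *\<^sub>v x) \<le> c * vec_norm2 x"
    and c: "0 \<le> c"
  shows "singular_value (1 + r) Y \<le> c"
proof (cases "1 + r \<le> min m p")
  case True
  then have r: "r < p" by simp
  obtain P s where P: "unitary p P" and s: "\<And>i. i < p \<Longrightarrow> 0 \<le> s i"
    and quad: "\<And>y. y \<in> carrier_vec p \<Longrightarrow> (vec_norm2 (Y *\<^sub>v (P *\<^sub>v y)))\<^sup>2 = (\<Sum>i<p. (s i)\<^sup>2 * (cmod (y $ i))\<^sup>2)"
    and sv: "singular_values Y = rev (sort (map s [0..<p]))"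
    using singular_values_orthogonal[OF Y] by blast
  note cP = unitary_carrier[OF P]
  let ?xs = "map s [0..<p]"
  define S where "S = singular_value (1 + r) Y"
  have S: "S = rev (sort ?xs) ! r" using Y True sv by (simp add: singular_value_def S_def)
  have "S \<in> set ?xs" unfolding S using nth_mem[of r "rev (sort ?xs)"] r by simp
  then have S0: "0 \<le> S" using s by auto
  \<comment> \<open>More than \<open>r\<close> right singular directions are stretched by at least
    \<open>S\<close>. Their span is too large for the \<open>r\<close> conditions imposed by
    \<open>V\<close> to leave only the zero vector.\<close>
  define J where "J = {i. i < p \<and> S \<le> s i}"
  have "{i. i < length ?xs \<and> rev (sort ?xs) ! r \<le> ?xs ! i} = J"
    unfolding J_def S by auto
  then have J: "r < card J" "J \<subseteq> {..<p}" using card_ge_nth_rev_sort[of r ?xs] r by (auto simp: J_def)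
  obtain y where y: "y \<in> carrier_vec p" "y \<noteq> 0\<^sub>v p" "(V * P) *\<^sub>v y = 0\<^sub>v r"
    and yJ: "\<And>i. i < p \<Longrightarrow> i \<notin> J \<Longrightarrow> y $ i = 0"
    using supported_kernel_vector[OF mult_carrier_mat[OF V cP] J(2,1)] by blast
  have Py: "P *\<^sub>v y \<in> carrier_vec p" using cP y by simp
  have V0: "V *\<^sub>v (P *\<^sub>v y) = 0\<^sub>v r" using y(3) assoc_mult_mat_vec[OF V cP y(1)] by simp
  have "(S * vec_norm2 y)\<^sup>2 = (\<Sum>i<p. S\<^sup>2 * (cmod (y $ i))\<^sup>2)"
    by (simp add: power_mult_distrib vec_norm2_sq[OF y(1)] sum_distrib_left)
  also have "\<dots> \<le> (\<Sum>i<p. (s i)\<^sup>2 * (cmod (y $ i))\<^sup>2)"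
  proof (rule sum_mono)
    fix i assume "i \<in> {..<p}"
    then show "S\<^sup>2 * (cmod (y $ i))\<^sup>2 \<le> (s i)\<^sup>2 * (cmod (y $ i))\<^sup>2"
      using yJ[of i] S0 by (cases "i \<in> J") (auto simp: J_def intro!: mult_right_mono power_mono)
  qed
  also have "\<dots> = (vec_norm2 (Y *\<^sub>v (P *\<^sub>v y)))\<^sup>2" using quad[OF y(1)] by simp
  finally have "S * vec_norm2 y \<le> vec_norm2 (Y *\<^sub>v (P *\<^sub>v y))"
    by (rule power2_le_imp_le) simp
  also have "\<dots> \<le> c * vec_norm2 y" using bound[OF Py V0] unitary_norm[OF P y(1)] by simp
  finally have "S * vec_norm2 y \<le> c * vec_norm2 y" .
  moreover have "0 < vec_norm2 y"
    using vec_norm2_eq_0_iff[OF y(1)] y(2) vec_norm2_nonneg[of y] by linarith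
  ultimately show ?thesis unfolding S_def by simp
next
  case False
  \<comment> \<open>Here \<open>1 + r\<close> exceeds the smaller dimension, so the singular value
    is 0 by convention.\<close>
  then show ?thesis using Y c by (auto simp: singular_value_def)
qed

text \<open>A real supremum says something only about a bounded set;
  \<open>singular_value 1 M\<close> serves as the bound. The inequality for general \<open>x\<close>
  follows by scaling to length 1.\<close>

lemma vec_norm2_mult_le_mat_norm2:
  assumes M: "M \<in> carrier_mat m p" and x: "x \<in> carrier_vec p" and "0 < m" "0 < p"
  shows "vec_norm2 (M *\<^sub>v x) \<le> mat_norm2 M * vec_norm2 x"
proof (cases "x = 0\<^sub>v p")
  case True
  then have "M *\<^sub>v x = 0\<^sub>v m" using M by (intro eq_vecI) auto
  then show ?thesis using True vec_norm2_eq_0_iff[of "0\<^sub>v m" m] vec_norm2_eq_0_iff[of x p] by simp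
next
  case False
  then have pos: "0 < vec_norm2 x" using vec_norm2_eq_0_iff[OF x] vec_norm2_nonneg[of x] by linarith
  define c where "c = complex_of_real (1 / vec_norm2 x)"
  have cx: "c \<cdot>\<^sub>v x \<in> carrier_vec p" using x by simp
  have nc: "vec_norm2 (c \<cdot>\<^sub>v x) = 1" using pos by (simp add: vec_norm2_smult c_def norm_divide)
  have "bdd_above {vec_norm2 (M *\<^sub>v x) | x. x \<in> carrier_vec (dim_col M) \<and> vec_norm2 x = 1}"
  proof (rule bdd_aboveI)
    fix z assume "z \<in> {vec_norm2 (M *\<^sub>v x) | x. x \<in> carrier_vec (dim_col M) \<and> vec_norm2 x = 1}"
    then show "z \<le> singular_value 1 M"
      using vec_norm2_mult_le_singular_value[OF M _ assms(3,4)] M by force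
  qed
  then have "vec_norm2 (M *\<^sub>v (c \<cdot>\<^sub>v x)) \<le> mat_norm2 M"
    unfolding mat_norm2_def by (rule cSup_upper[rotated]) (use M cx nc in auto)
  also have "M *\<^sub>v (c \<cdot>\<^sub>v x) = c \<cdot>\<^sub>v (M *\<^sub>v x)" by (rule mult_mat_vec[OF M x])
  finally have "vec_norm2 (M *\<^sub>v x) / vec_norm2 x \<le> mat_norm2 M"
    by (simp add: vec_norm2_smult c_def norm_divide)
  then show ?thesis using pos by (simp add: field_simps)
qed

section \<open>Rational functions of matrices\<close>

text \<open>In characteristic 0 every differentiation lowers the order of a zero by exactly
  one.\<close>

lemma higher_pderiv_at_order:
  fixes R :: "'a :: field_char_0 poly"
  assumes "R \<noteq> 0"
  shows "poly ((pderiv ^^ order z R) R) z \<noteq> 0"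
  using assms
proof (induct "order z R" arbitrary: R)
  case 0
  then show ?case using order_root[of R z] by simp
next
  case (Suc k)
  have R': "pderiv R \<noteq> 0"
  proof
    assume "pderiv R = 0"
    then have "degree R = 0" by (simp add: pderiv_eq_0_iff)
    then obtain c where "R = [:c:]" by (rule degree_eq_zeroE)
    moreover have "poly R z = 0" using Suc(2) by (simp add: order_root)
    ultimately show False using Suc(3) by simp
  qed
  have o: "order z R = Suc (order z (pderiv R))"
    using Suc(2) by (intro order_pderiv[OF Suc(3)]) (simp add: order_root)
  have "poly ((pderiv ^^ order z (pderiv R)) (pderiv R)) z \<noteq> 0"
    using Suc(2) o by (intro Suc(1)[OF _ R']) simp
  then show ?case unfolding o by (simp add: funpow_swap1)
qed

lemma dvd_of_order_le:
  fixes p r :: "complex poly"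
  assumes "p \<noteq> 0" "r \<noteq> 0" "\<And>z. order z p \<le> order z r"
  shows "p dvd r"
proof -
  have "proots p \<subseteq># proots r"
    using assms by (intro mset_subset_eqI) auto
  then have "(\<Prod>x\<in>#proots p. [:-x, 1:]) dvd (\<Prod>x\<in>#proots r. [:-x, 1:])"
    by (intro prod_mset_subset_imp_dvd image_mset_subseteq_mono)
  then have "smult (lead_coeff p) (\<Prod>x\<in>#proots p. [:-x, 1:]) dvd smult (lead_coeff r) (\<Prod>x\<in>#proots r. [:-x, 1:])"
    using assms by (simp add: smult_dvd_iff dvd_smult)
  then show ?thesis by (simp only: complex_poly_decompose_multiset)
qed

lemma dvd_of_higher_pderiv:
  fixes p r :: "complex poly"
  assumes p: "p \<noteq> 0" and r: "\<And>z i. i < order z p \<Longrightarrow> poly ((pderiv ^^ i) r) z = 0"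
  shows "p dvd r"
proof (cases "r = 0")
  case False
  show ?thesis
  proof (rule dvd_of_order_le[OF p False])
    fix z show "order z p \<le> order z r"
      using r[of "order z r" z] higher_pderiv_at_order[OF False, of z] by (cases "order z r < order z p") auto
  qed
qed simp

lemma higher_pderiv_diff: "(pderiv ^^ i) (p - q) = (pderiv ^^ i) p - (pderiv ^^ i) (q :: 'a :: idom poly)"
  by (induct i) (auto simp: pderiv_diff)

lemma higher_deriv_poly: "(deriv ^^ i) (poly p) = poly ((pderiv ^^ i) (p :: complex poly))"
proof (induct i arbitrary: p)
  case (Suc i)
  have "deriv (poly p) = poly (pderiv p)" by (rule ext) (rule DERIV_imp_deriv[OF poly_DERIV])
  then show ?case using Suc by (simp add: funpow_Suc_right del: funpow.simps)
qed simp

text \<open>The factor \<open>g\<close> has to be arbitrary in the induction: differentiating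
  reproduces the same shape with exponent one lower and \<open>g\<close> replaced by m g + (w - z)
  g', which is again holomorphic.\<close>

lemma higher_deriv_multiple_zero:
  assumes "open S" "z \<in> S" "g holomorphic_on S" "i < m"
  shows "(deriv ^^ i) (\<lambda>w. (w - z) ^ m * g w) z = 0"
  using assms(3,4)
proof (induct i arbitrary: m g)
  case 0
  then show ?case by simp
next
  case (Suc i)
  obtain m' where m: "m = Suc m'" "i < m'" using Suc.prems(2) by (cases m) auto
  let ?h = "\<lambda>w. of_nat m * g w + (w - z) * deriv g w"
  have g': "deriv g holomorphic_on S" by (rule holomorphic_deriv[OF Suc.prems(1) assms(1)])
  have h: "?h holomorphic_on S" by (intro holomorphic_intros Suc.prems(1) g')
  have d: "deriv (\<lambda>w. (w - z) ^ m * g w) w = (w - z) ^ m' * ?h w" if "w \<in> S" for w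
  proof -
    have "(g has_field_derivative deriv g w) (at w)"
      by (rule holomorphic_derivI[OF Suc.prems(1) assms(1) that])
    then have "((\<lambda>w. (w - z) ^ m * g w) has_field_derivative
        of_nat m * (w - z) ^ (m - 1) * g w + (w - z) ^ m * deriv g w) (at w)"
      by (auto intro!: derivative_eq_intros)
    also have "of_nat m * (w - z) ^ (m - 1) * g w + (w - z) ^ m * deriv g w = (w - z) ^ m' * ?h w"
      unfolding m(1) by (simp add: algebra_simps)
    finally have "((\<lambda>w. (w - z) ^ m * g w) has_field_derivative (w - z) ^ m' * ?h w) (at w)" .
    then show ?thesis by (rule DERIV_imp_deriv)
  qed
  have "(deriv ^^ Suc i) (\<lambda>w. (w - z) ^ m * g w) z = (deriv ^^ i) (deriv (\<lambda>w. (w - z) ^ m * g w)) z"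
    by (simp add: funpow_Suc_right del: funpow.simps)
  also have "\<dots> = (deriv ^^ i) (\<lambda>w. (w - z) ^ m' * ?h w) z"
  proof (rule higher_deriv_transform_within_open[OF _ _ assms(1,2) d])
    show "deriv (\<lambda>w. (w - z) ^ m * g w) holomorphic_on S"
      by (intro holomorphic_deriv[OF _ assms(1)] holomorphic_intros Suc.prems(1))
    show "(\<lambda>w. (w - z) ^ m' * ?h w) holomorphic_on S" by (intro holomorphic_intros h)
  qed
  also have "\<dots> = 0" by (rule Suc.hyps[OF h m(2)])
  finally show ?case .
qed

text \<open>Near an eigenvalue \<open>z\<close> of multiplicity m, divisibility gives h - p/q = (w -
  z)^m u/q with q nonzero at z, so the derivatives of order below m agree.\<close>

lemma hermite_interpolates_rational:
  assumes q: "\<And>z. poly (char_poly M) z = 0 \<Longrightarrow> poly q z \<noteq> 0"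
    and dvd: "char_poly M dvd q * h - p" and M: "char_poly M \<noteq> 0"
  shows "hermite_interpolates h (\<lambda>z. poly p z / poly q z) M"
  unfolding hermite_interpolates_def
proof (intro allI impI)
  fix z i assume i: "i < order z (char_poly M)"
  let ?m = "order z (char_poly M)" and ?f = "\<lambda>z. poly p z / poly q z"
  define S where "S = {w. poly q w \<noteq> 0}"
  have S: "open S"
    unfolding S_def by (intro open_Collect_neq continuous_intros)
  have "poly (char_poly M) z = 0" using i M by (simp add: order_root)
  then have z: "z \<in> S" using q by (simp add: S_def)
  have "[:-z, 1:] ^ ?m dvd q * h - p" by (rule dvd_trans[OF order_1 dvd])
  then obtain u where u: "q * h - p = [:-z, 1:] ^ ?m * u" by (rule dvdE)
  have f: "?f holomorphic_on S" by (intro holomorphic_intros) (auto simp: S_def)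
  have h: "poly h holomorphic_on S" by (intro holomorphic_intros)
  have g: "(\<lambda>w. poly u w / poly q w) holomorphic_on S" by (intro holomorphic_intros) (auto simp: S_def)
  have eq: "poly h w - ?f w = (w - z) ^ ?m * (poly u w / poly q w)" if "w \<in> S" for w
  proof -
    have "poly q w * poly h w - poly p w = (w - z) ^ ?m * poly u w"
      using arg_cong[OF u, of "\<lambda>r. poly r w"] by (simp add: poly_power)
    then show ?thesis using that by (simp add: S_def field_simps)
  qed
  have "(deriv ^^ i) (poly h) z - (deriv ^^ i) ?f z = (deriv ^^ i) (\<lambda>w. poly h w - ?f w) z"
    by (rule higher_deriv_diff[OF h f S z, symmetric])
  also have "\<dots> = (deriv ^^ i) (\<lambda>w. (w - z) ^ ?m * (poly u w / poly q w)) z"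
    by (rule higher_deriv_transform_within_open[OF _ _ S z eq]) (intro holomorphic_intros h f g)+
  also have "\<dots> = 0" by (rule higher_deriv_multiple_zero[OF S z g i])
  finally show "poly ((pderiv ^^ i) h) z = (deriv ^^ i) ?f z" by (simp add: higher_deriv_poly)
qed

lemma char_poly_nonzero: "M \<in> carrier_mat n n \<Longrightarrow> char_poly M \<noteq> (0 :: 'a :: comm_ring_1 poly)"
  using degree_monic_char_poly[of M n] by auto

text \<open>Over the complex numbers a gcd without roots is constant, so the Bezout identity can be
  rescaled to 1.\<close>

lemma bezout_no_common_root:
  fixes p q :: "complex poly"
  assumes "q \<noteq> 0" "\<And>z. poly q z = 0 \<Longrightarrow> poly p z \<noteq> 0"
  obtains x y where "x * p + y * q = 1"
proof -
  obtain a b where ab: "bezout_coefficients p q = (a, b)" by force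
  have g: "a * p + b * q = gcd p q" by (rule bezout_coefficients[OF ab])
  have "degree (gcd p q) = 0"
  proof (rule ccontr)
    assume "degree (gcd p q) \<noteq> 0"
    then have "\<not> constant (poly (gcd p q))" by (simp add: constant_degree)
    then have "\<exists>z. poly (gcd p q) z = 0"
      by (rule Fundamental_Theorem_Algebra.fundamental_theorem_of_algebra)
    then obtain z where z: "poly (gcd p q) z = 0" ..
    then have "[:-z, 1:] dvd gcd p q" by (simp add: poly_eq_0_iff_dvd)
    then have "[:-z, 1:] dvd p" "[:-z, 1:] dvd q"
      using dvd_trans[OF _ gcd_dvd1] dvd_trans[OF _ gcd_dvd2] by auto
    then show False using assms(2)[of z] by (simp add: poly_eq_0_iff_dvd)
  qed
  then obtain c where c: "gcd p q = [:c:]" by (rule degree_eq_zeroE)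
  have "gcd p q \<noteq> 0" using assms(1) by simp
  then have "c \<noteq> 0" using c by auto
  have "smult (1 / c) a * p + smult (1 / c) b * q = smult (1 / c) (a * p + b * q)"
    by (simp add: smult_add_right)
  also have "\<dots> = 1" unfolding g c using \<open>c \<noteq> 0\<close> by (simp add: one_pCons)
  finally show thesis by (rule that)
qed

text \<open>Makes the choice in \<open>mat_fun\<close> harmless. With \<open>x\<close> inverse to
  \<open>q\<close> modulo the characteristic polynomial, \<open>x * p\<close> is one interpolant;
  any other differs from it by a multiple of that polynomial, hence satisfies q h = p modulo it, and
  Cayley-Hamilton turns this congruence into an identity of matrices.\<close>

lemma mat_fun_rational:
  assumes M: "M \<in> carrier_mat n n"
    and q: "\<And>z. poly (char_poly M) z = 0 \<Longrightarrow> poly q z \<noteq> 0"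
  obtains h where "mat_fun (\<lambda>z. poly p z / poly q z) M = poly_of_mat h M"
    "poly_of_mat q M * poly_of_mat h M = poly_of_mat p M"
proof -
  let ?f = "\<lambda>z. poly p z / poly q z" and ?c = "char_poly M"
  have c0: "?c \<noteq> 0" by (rule char_poly_nonzero[OF M])
  obtain x y where xy: "x * q + y * ?c = 1"
    using bezout_no_common_root[OF c0 q] by blast
  have "q * (x * p) - p = p * (x * q + y * ?c) - p - ?c * (y * p)" by (simp add: algebra_simps)
  also have "\<dots> = ?c * (- (y * p))" unfolding xy by simp
  finally have dvd: "?c dvd q * (x * p) - p" by (rule dvdI)
  define h where "h = (SOME h. hermite_interpolates h ?f M)"
  have h0: "hermite_interpolates (x * p) ?f M"
    by (rule hermite_interpolates_rational[OF q dvd c0])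
  then have h: "hermite_interpolates h ?f M" unfolding h_def by (rule someI)
  \<comment> \<open>Both interpolate the same data, so the derivatives of the difference vanish to
    the order of each eigenvalue.\<close>
  have "?c dvd h - x * p"
    using h h0 by (intro dvd_of_higher_pderiv[OF c0])
      (simp add: higher_pderiv_diff hermite_interpolates_def)
  then have "?c dvd q * (h - x * p) + (q * (x * p) - p)" using dvd by simp
  then have "?c dvd q * h - p" by (simp add: algebra_simps)
  then obtain u where "q * h - p = ?c * u" by (rule dvdE)
  then have u: "q * h = p + ?c * u" by (simp add: algebra_simps)
  have "poly_of_mat q M * poly_of_mat h M = poly_of_mat (p + ?c * u) M"
    by (simp add: poly_of_mat_mult[OF M] flip: u)
  also have "\<dots> = poly_of_mat p M + poly_of_mat ?c M * poly_of_mat u M"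
    by (simp add: poly_of_mat_mult[OF M] poly_of_mat_add[OF M])
  also have "\<dots> = poly_of_mat p M"
    unfolding Cayley_Hamilton[OF M]
    using left_mult_zero_mat[OF poly_of_mat_carrier[OF M], of n] right_add_zero_mat[OF poly_of_mat_carrier[OF M]] by simp
  finally show thesis by (intro that[of h]) (simp_all add: mat_fun_def h_def)
qed

lemma poly_of_mat_left_inverse:
  assumes M: "M \<in> carrier_mat n n"
    and q: "\<And>z. poly (char_poly M) z = 0 \<Longrightarrow> poly q z \<noteq> 0"
  obtains x where "poly_of_mat x M * poly_of_mat q M = 1\<^sub>m n"
proof -
  obtain x where x: "poly_of_mat q M * poly_of_mat x M = poly_of_mat 1 M"
    using mat_fun_rational[OF M q, where p = 1] by blast
  then show thesis using that[of x] poly_of_mat_commute[OF M, of q x] M by simp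
qed

section \<open>The bound for one rational function\<close>

lemma field_of_valuesI:
  assumes "A \<in> carrier_mat n n" "x \<in> carrier_vec n" "x \<noteq> 0\<^sub>v n"
  shows "((A *\<^sub>v x) \<bullet>c x) / (x \<bullet>c x) \<in> field_of_values A"
  using assms unfolding field_of_values_def by auto

text \<open>The Rayleigh quotient at an eigenvector is the eigenvalue. This keeps the spectra of
  \<open>A\<close> and \<open>D\<close> away from the roots of the denominators.\<close>

lemma root_char_poly_in_field_of_values:
  assumes A: "A \<in> carrier_mat n n" and z: "poly (char_poly A) z = 0"
  shows "z \<in> field_of_values A"
proof -
  have "eigenvalue A z" using z by (simp add: eigenvalue_root_char_poly[OF A])
  then obtain v where v: "v \<in> carrier_vec n" "v \<noteq> 0\<^sub>v n" "A *\<^sub>v v = z \<cdot>\<^sub>v v"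
    using A by (auto simp: eigenvalue_def eigenvector_def)
  have "v \<bullet>c v \<noteq> 0" using v conjugate_square_eq_0_vec[OF v(1)] by simp
  moreover have "(A *\<^sub>v v) \<bullet>c v = z * (v \<bullet>c v)"
    unfolding v(3) using v(1) by (intro smult_scalar_prod_distrib[of _ n]) auto
  ultimately show ?thesis using field_of_valuesI[OF A v(1,2)] by simp
qed

text \<open>Shows that the infimum defining Crouzeix's constant itself satisfies the defining
  inequality. For \<open>s = 0\<close> one finite member of \<open>K\<close> suffices; the
  hypothesis on \<open>Inf K\<close> guarantees that \<open>K\<close> is nonempty.\<close>

lemma ennreal_le_Inf_mult:
  fixes s :: ennreal
  assumes "\<And>c. c \<in> K \<Longrightarrow> a \<le> c * s" and K: "Inf K \<noteq> \<infinity>" and s: "s \<noteq> \<infinity>"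
  shows "a \<le> Inf K * s"
proof (cases "s = 0")
  case True
  have "K \<noteq> {}" using K by auto
  then show ?thesis using assms(1) True by auto
next
  case False
  have "a / s \<le> Inf K"
    using False assms(1) by (intro Inf_greatest divide_le_posI_ennreal) (auto simp: mult.commute zero_less_iff_neq_zero)
  then have "a / s * s \<le> Inf K * s" by (rule mult_right_mono) simp
  moreover have "a / s * s = a"
    using False s by (simp add: ennreal_divide_times top.not_eq_extremum)
  ultimately show ?thesis by simp
qed

lemma vec_norm2_unit: "i < n \<Longrightarrow> vec_norm2 (unit_vec n i) = 1"
proof -
  assume i: "i < n"
  have "(vec_norm2 (unit_vec n i))\<^sup>2 = (\<Sum>j<n. if j = i then 1 else 0)"
    unfolding vec_norm2_sq[OF unit_vec_carrier] using i by (intro sum.cong) auto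
  also have "\<dots> = 1\<^sup>2" using i by simp
  finally show ?thesis by (simp only: power2_eq_iff_nonneg[OF vec_norm2_nonneg zero_le_one])
qed

lemma mat_norm2_nonneg:
  assumes M: "M \<in> carrier_mat m p" and "0 < m" "0 < p"
  shows "0 \<le> mat_norm2 M"
  using order_trans[OF vec_norm2_nonneg vec_norm2_mult_le_mat_norm2[OF M unit_vec_carrier assms(2,3)], of 0]
    vec_norm2_unit[OF assms(3)] by simp

lemma crouzeix_constant_le:
  assumes "M \<in> carrier_mat n n" "n \<ge> 1" "open S" "field_of_values M \<subseteq> S" "f holomorphic_on S"
    and "crouzeix_constant \<noteq> \<infinity>" "(SUP z\<in>field_of_values M. ennreal (cmod (f z))) \<noteq> \<infinity>"
  shows "ennreal (mat_norm2 (mat_fun f M)) \<le> crouzeix_constant * (SUP z\<in>field_of_values M. ennreal (cmod (f z)))"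
  using assms(6) unfolding crouzeix_constant_def
  by (rule ennreal_le_Inf_mult[rotated]) (use assms in auto)

text \<open>Tested on the constant function 1 and the identity of size 1. The lower bound ensures
  that the squared constant is nonzero when it is moved past the infimum over
  \<open>r\<close>.\<close>

lemma one_le_crouzeix_constant: "1 \<le> crouzeix_constant"
  unfolding crouzeix_constant_def
proof (rule Inf_greatest)
  fix c :: ennreal
  \<comment> \<open>Writing the constant function as 1/1 brings it into the scope of
    \<open>mat_fun_rational\<close>.\<close>
  let ?I = "1\<^sub>m 1 :: complex mat" and ?f = "\<lambda>z. poly 1 z / poly 1 z :: complex"
  assume "c \<in> {c. \<forall>n M f S. n \<ge> 1 \<longrightarrow> M \<in> carrier_mat n n \<longrightarrow> open S \<longrightarrow> field_of_values M \<subseteq> S \<longrightarrow>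
               f holomorphic_on S \<longrightarrow>
               ennreal (mat_norm2 (mat_fun f M)) \<le> c * (SUP z\<in>field_of_values M. ennreal (cmod (f z)))}"
  then have c: "n \<ge> 1 \<longrightarrow> M \<in> carrier_mat n n \<longrightarrow> open S \<longrightarrow> field_of_values M \<subseteq> S \<longrightarrow>
               f holomorphic_on S \<longrightarrow>
               ennreal (mat_norm2 (mat_fun f M)) \<le> c * (SUP z\<in>field_of_values M. ennreal (cmod (f z)))" for n M S f
    by blast
  have I: "?I \<in> carrier_mat 1 1" by simp
  have "ennreal (mat_norm2 (mat_fun ?f ?I)) \<le> c * (SUP z\<in>field_of_values ?I. ennreal (cmod (?f z)))"
    using c[of 1 ?I UNIV ?f] by simp
  also have "\<dots> \<le> c * 1" by (intro mult_left_mono SUP_least) auto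
  finally have le: "ennreal (mat_norm2 (mat_fun ?f ?I)) \<le> c" by simp
  obtain h where h: "mat_fun ?f ?I = poly_of_mat h ?I" "poly_of_mat 1 ?I * poly_of_mat h ?I = poly_of_mat 1 ?I"
    using mat_fun_rational[OF I, where p = 1 and q = 1] by auto
  have "poly_of_mat h ?I = ?I"
    using h(2) left_mult_one_mat[OF poly_of_mat_carrier[OF I, of h]] by (simp only: poly_of_mat_1[OF I])
  then have "1 \<le> mat_norm2 (mat_fun ?f ?I)"
    using vec_norm2_mult_le_mat_norm2[OF I unit_vec_carrier, of 0] vec_norm2_unit[of 0 1] h(1) by simp
  then show "1 \<le> c" using le by (metis ennreal_1 ennreal_leI order_trans)
qed

lemma ennreal_inverse_antimono: "x \<le> y \<Longrightarrow> inverse y \<le> inverse (x :: ennreal)"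
  including ennreal.lifting by transfer (rule ereal_inverse_antimono)

lemma ratfun_abs_eq: "poly q z \<noteq> 0 \<Longrightarrow> ratfun_abs p q z = ennreal (cmod (poly p z / poly q z))"
  by (simp add: ratfun_abs_def)

lemma singular_value_1_pos:
  assumes Y: "Y \<in> carrier_mat m p" and "0 < m" "0 < p" and Y0: "Y \<noteq> 0\<^sub>m m p"
  shows "0 < singular_value 1 Y"
proof (rule ccontr)
  assume neg: "\<not> 0 < singular_value 1 Y"
  have "Y = 0\<^sub>m m p"
  proof (rule eq_matI)
    fix i j assume "i < dim_row (0\<^sub>m m p :: complex mat)" "j < dim_col (0\<^sub>m m p :: complex mat)"
    then have ij: "i < m" "j < p" by auto
    have u: "unit_vec p j \<in> carrier_vec p" by simp
    have "vec_norm2 (Y *\<^sub>v unit_vec p j) \<le> singular_value 1 Y * vec_norm2 (unit_vec p j)"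
      by (rule vec_norm2_mult_le_singular_value[OF Y u assms(2,3)])
    then have "vec_norm2 (Y *\<^sub>v unit_vec p j) = 0"
      using vec_norm2_nonneg[of "Y *\<^sub>v unit_vec p j"] neg unfolding vec_norm2_unit[OF ij(2)] mult_1_right
      by linarith
    then have eq: "Y *\<^sub>v unit_vec p j = 0\<^sub>v m"
      using vec_norm2_eq_0_iff[of "Y *\<^sub>v unit_vec p j" m] Y by simp
    show "Y $$ (i, j) = 0\<^sub>m m p $$ (i, j)"
      using arg_cong[OF eq, of "\<lambda>v. v $ i"] Y ij by simp
  qed (use Y in auto)
  then show False using Y0 by simp
qed

text \<open>The matrices \<open>a\<close> and \<open>b\<close> are \<open>r(A)\<close> and
  \<open>(1/r)(D)\<close>. Clearing denominators identifies \<open>R = a Y b - Y\<close> with the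
  low-rank exchange difference \<open>K\<close>, up to invertible factors on both sides. On the
  kernel of its right factor \<open>V\<close> the matrix \<open>Y\<close> thus agrees with
  \<open>a Y b\<close>.\<close>

lemma singular_value_ratio_le_rational:
  fixes A D Y :: "complex mat"
  assumes A: "A \<in> carrier_mat m m" and D: "D \<in> carrier_mat p p" and Y: "Y \<in> carrier_mat m p"
    and m: "0 < m" and p: "0 < p" and Y0: "Y \<noteq> 0\<^sub>m m p"
    and G: "rank_le k (A * Y - Y * D)"
    and deg: "degree P \<le> l" "degree Q \<le> l" and cop: "coprime P Q"
    and AE: "field_of_values A \<subseteq> E" and DF: "field_of_values D \<subseteq> F"
    and C: "crouzeix_constant \<noteq> \<infinity>"
    and S: "S = (SUP x\<in>E. ratfun_abs P Q x)" "S \<noteq> \<infinity>"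
    and T: "T = (INF y\<in>F. ratfun_abs P Q y)" "T \<noteq> 0"
  shows "ennreal (singular_value (1 + k * l) Y / singular_value 1 Y) \<le> crouzeix_constant\<^sup>2 * (S / T)"
proof -
  have Sx: "ratfun_abs P Q x \<le> S" if "x \<in> E" for x using S(1) that by (auto intro: SUP_upper)
  have Tx: "T \<le> ratfun_abs P Q y" if "y \<in> F" for y using T(1) that by (auto intro: INF_lower)
  have QE: "poly Q x \<noteq> 0" if "x \<in> E" for x
    using Sx[OF that] S(2) by (auto simp: ratfun_abs_def top_unique)
  \<comment> \<open>By coprimality a zero of \<open>P\<close> is not a zero of \<open>Q\<close>, so
    \<open>r\<close> would vanish there and force \<open>T = 0\<close>.\<close>
  have PF: "poly P y \<noteq> 0" if "y \<in> F" for y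
  proof
    assume P0: "poly P y = 0"
    have "poly Q y \<noteq> 0" using cop P0 by (metis coprime_poly_0)
    then show False using Tx[OF that] P0 T(2) by (simp add: ratfun_abs_def)
  qed
  have QA: "poly (char_poly A) z = 0 \<Longrightarrow> poly Q z \<noteq> 0" for z
    using root_char_poly_in_field_of_values[OF A] AE QE by blast
  have PD: "poly (char_poly D) z = 0 \<Longrightarrow> poly P z \<noteq> 0" for z
    using root_char_poly_in_field_of_values[OF D] DF PF by blast
  obtain h where h: "mat_fun (\<lambda>z. poly P z / poly Q z) A = poly_of_mat h A"
      "poly_of_mat Q A * poly_of_mat h A = poly_of_mat P A"
    using mat_fun_rational[OF A QA, where p = P] by blast
  obtain g where g: "mat_fun (\<lambda>z. poly Q z / poly P z) D = poly_of_mat g D"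
      "poly_of_mat P D * poly_of_mat g D = poly_of_mat Q D"
    using mat_fun_rational[OF D PD, where p = Q] by blast
  obtain x where x: "poly_of_mat x A * poly_of_mat Q A = 1\<^sub>m m"
    using poly_of_mat_left_inverse[OF A QA] by blast
  obtain y where "poly_of_mat y D * poly_of_mat P D = 1\<^sub>m p"
    using poly_of_mat_left_inverse[OF D PD] by blast
  then have y: "poly_of_mat P D * poly_of_mat y D = 1\<^sub>m p" by (simp add: poly_of_mat_commute[OF D])
  define a b where "a = poly_of_mat h A" and "b = poly_of_mat g D"
  have a: "a \<in> carrier_mat m m" and b: "b \<in> carrier_mat p p" using A D by (auto simp: a_def b_def)
  note cA = poly_of_mat_carrier[OF A] and cD = poly_of_mat_carrier[OF D]
  have na: "ennreal (mat_norm2 a) \<le> crouzeix_constant * S"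
  proof -
    have le: "(SUP z\<in>field_of_values A. ennreal (cmod (poly P z / poly Q z))) \<le> S"
    proof (rule SUP_least)
      fix z assume "z \<in> field_of_values A"
      then have "z \<in> E" using AE by auto
      then show "ennreal (cmod (poly P z / poly Q z)) \<le> S"
        using Sx[of z] QE[of z] by (simp add: ratfun_abs_eq)
    qed
    then have fin: "(SUP z\<in>field_of_values A. ennreal (cmod (poly P z / poly Q z))) \<noteq> \<infinity>"
      unfolding infinity_ennreal_def by (rule neq_top_trans[rotated]) (use S(2) in simp)
    have "ennreal (mat_norm2 a) \<le> crouzeix_constant * (SUP z\<in>field_of_values A. ennreal (cmod (poly P z / poly Q z)))"
      unfolding a_def h(1)[symmetric]
    proof (rule crouzeix_constant_le[OF A])
      show "open {z. poly Q z \<noteq> 0}" by (intro open_Collect_neq continuous_intros)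
      show "(\<lambda>z. poly P z / poly Q z) holomorphic_on {z. poly Q z \<noteq> 0}" by (intro holomorphic_intros) auto
    qed (use m AE QE C fin in auto)
    also have "\<dots> \<le> crouzeix_constant * S" by (intro mult_left_mono le) auto
    finally show ?thesis .
  qed
  have nb: "ennreal (mat_norm2 b) \<le> crouzeix_constant * inverse T"
  proof -
    have le: "(SUP z\<in>field_of_values D. ennreal (cmod (poly Q z / poly P z))) \<le> inverse T"
    proof (rule SUP_least)
      fix z assume "z \<in> field_of_values D"
      then have z: "z \<in> F" using DF by auto
      \<comment> \<open>At a pole of \<open>r\<close> both sides are 0: the numerator
        \<open>Q\<close> vanishes, and the inverse of infinity is 0.\<close>
      have "ennreal (cmod (poly Q z / poly P z)) = inverse (ratfun_abs P Q z)"
        using PF[OF z] by (auto simp: ratfun_abs_def inverse_ennreal norm_divide)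
      also have "\<dots> \<le> inverse T" by (rule ennreal_inverse_antimono[OF Tx[OF z]])
      finally show "ennreal (cmod (poly Q z / poly P z)) \<le> inverse T" .
    qed
    have "inverse T \<noteq> \<infinity>" using T(2) by simp
    then have fin: "(SUP z\<in>field_of_values D. ennreal (cmod (poly Q z / poly P z))) \<noteq> \<infinity>"
      unfolding infinity_ennreal_def by (rule neq_top_trans[OF _ le])
    have "ennreal (mat_norm2 b) \<le> crouzeix_constant * (SUP z\<in>field_of_values D. ennreal (cmod (poly Q z / poly P z)))"
      unfolding b_def g(1)[symmetric]
    proof (rule crouzeix_constant_le[OF D])
      show "open {z. poly P z \<noteq> 0}" by (intro open_Collect_neq continuous_intros)
      show "(\<lambda>z. poly Q z / poly P z) holomorphic_on {z. poly P z \<noteq> 0}" by (intro holomorphic_intros) auto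
    qed (use p DF PF C fin in auto)
    also have "\<dots> \<le> crouzeix_constant * inverse T" by (intro mult_left_mono le) auto
    finally show ?thesis .
  qed
  define K where "K = poly_of_mat P A * Y * poly_of_mat Q D - poly_of_mat Q A * Y * poly_of_mat P D"
  \<comment> \<open>The identity factors give both terms the shape required by
    \<open>sandwich_diff\<close>.\<close>
  define R where "R = a * Y * b - 1\<^sub>m m * Y * 1\<^sub>m p"
  have aYb: "a * Y * b \<in> carrier_mat m p" by (rule mult_carrier_mat[OF mult_carrier_mat[OF a Y] b])
  have R: "R \<in> carrier_mat m p" unfolding R_def using Y by (intro minus_carrier_mat) auto
  have "poly_of_mat Q A * R * poly_of_mat P D = K"
  proof -
    have "poly_of_mat Q A * R * poly_of_mat P D
      = (poly_of_mat Q A * a) * Y * (b * poly_of_mat P D) - (poly_of_mat Q A * 1\<^sub>m m) * Y * (1\<^sub>m p * poly_of_mat P D)"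
      unfolding R_def by (rule sandwich_diff[OF cA a one_carrier_mat Y b one_carrier_mat cD])
    also have "b * poly_of_mat P D = poly_of_mat Q D"
      unfolding b_def poly_of_mat_commute[OF D, of g] by (rule g(2))
    also have "poly_of_mat Q A * a = poly_of_mat P A" unfolding a_def by (rule h(2))
    also have "poly_of_mat Q A * 1\<^sub>m m = poly_of_mat Q A" by (rule right_mult_one_mat[OF cA])
    also have "1\<^sub>m p * poly_of_mat P D = poly_of_mat P D" by (rule left_mult_one_mat[OF cD])
    finally show ?thesis by (simp only: K_def)
  qed
  moreover have "poly_of_mat x A * (poly_of_mat Q A * R * poly_of_mat P D) * poly_of_mat y D = R"
  proof -
    have QR: "poly_of_mat Q A * R \<in> carrier_mat m p" by (rule mult_carrier_mat[OF cA R])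
    have "poly_of_mat x A * (poly_of_mat Q A * R * poly_of_mat P D) * poly_of_mat y D
      = poly_of_mat x A * (poly_of_mat Q A * R) * poly_of_mat P D * poly_of_mat y D"
      by (simp only: assoc_mult_mat[OF cA QR cD])
    also have "poly_of_mat x A * (poly_of_mat Q A * R) = R"
      using assoc_mult_mat[OF cA cA R, of x Q] left_mult_one_mat[OF R] by (simp only: x)
    also have "R * poly_of_mat P D * poly_of_mat y D = R"
      using assoc_mult_mat[OF R cD cD, of P y] right_mult_one_mat[OF R] by (simp only: y)
    finally show ?thesis .
  qed
  moreover have "rank_le (k * l) K"
    unfolding K_def by (rule rank_le_poly_sylvester[OF A D Y G deg])
  moreover have K: "K \<in> carrier_mat m p"
    unfolding K_def by (intro minus_carrier_mat mult_carrier_mat[OF mult_carrier_mat[OF cA Y] cD])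
  ultimately have "rank_le (k * l) R"
    using rank_le_mult_right[OF mult_carrier_mat[OF cA K] cD rank_le_mult_left[OF cA K]] by metis
  then obtain U V where U: "U \<in> carrier_mat m (k * l)" and V: "V \<in> carrier_mat (k * l) p" and UV: "R = U * V"
    using rank_leE[OF _ R] by blast
  note na0 = mat_norm2_nonneg[OF a m m] and nb0 = mat_norm2_nonneg[OF b p p]
  let ?s = "singular_value 1 Y"
  have s: "0 < ?s" by (rule singular_value_1_pos[OF Y m p Y0])
  have "singular_value (1 + k * l) Y \<le> mat_norm2 a * ?s * mat_norm2 b"
  proof (rule singular_value_le[OF Y V])
    fix v :: "complex Matrix.vec" assume v: "v \<in> carrier_vec p" and Vv: "V *\<^sub>v v = 0\<^sub>v (k * l)"
    have bv: "b *\<^sub>v v \<in> carrier_vec p" using b v by simp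
    have Ybv: "Y *\<^sub>v (b *\<^sub>v v) \<in> carrier_vec m" using Y bv by simp
    have aYbv: "a *\<^sub>v (Y *\<^sub>v (b *\<^sub>v v)) \<in> carrier_vec m" using a Ybv by simp
    have Yv: "Y *\<^sub>v v \<in> carrier_vec m" using Y v by simp
    have "R *\<^sub>v v = 0\<^sub>v m"
      unfolding UV assoc_mult_mat_vec[OF U V v] Vv using U by (intro eq_vecI) auto
    moreover have "R *\<^sub>v v = a *\<^sub>v (Y *\<^sub>v (b *\<^sub>v v)) - Y *\<^sub>v v"
      unfolding R_def left_mult_one_mat[OF Y] right_mult_one_mat[OF Y] minus_mult_distrib_mat_vec[OF aYb Y v]
        assoc_mult_mat_vec[OF mult_carrier_mat[OF a Y] b v] assoc_mult_mat_vec[OF a Y bv] ..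
    ultimately have eq0: "a *\<^sub>v (Y *\<^sub>v (b *\<^sub>v v)) - Y *\<^sub>v v = 0\<^sub>v m" by simp
    have "Y *\<^sub>v v = a *\<^sub>v (Y *\<^sub>v (b *\<^sub>v v))"
    proof (rule eq_vecI)
      fix i assume "i < dim_vec (a *\<^sub>v (Y *\<^sub>v (b *\<^sub>v v)))"
      then have "i < m" using a by simp
      then show "(Y *\<^sub>v v) $ i = (a *\<^sub>v (Y *\<^sub>v (b *\<^sub>v v))) $ i"
        using arg_cong[OF eq0, of "\<lambda>w. w $ i"] carrier_vecD[OF Yv] carrier_vecD[OF aYbv]
        by (simp del: index_mult_mat_vec assoc_mult_mat_vec)
    qed (use a Y in auto)
    then have "vec_norm2 (Y *\<^sub>v v) = vec_norm2 (a *\<^sub>v (Y *\<^sub>v (b *\<^sub>v v)))" by simp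
    also have "\<dots> \<le> mat_norm2 a * vec_norm2 (Y *\<^sub>v (b *\<^sub>v v))"
      by (rule vec_norm2_mult_le_mat_norm2[OF a Ybv m m])
    also have "\<dots> \<le> mat_norm2 a * (?s * vec_norm2 (b *\<^sub>v v))"
      by (rule mult_left_mono[OF vec_norm2_mult_le_singular_value[OF Y bv m p] na0])
    also have "\<dots> \<le> mat_norm2 a * (?s * (mat_norm2 b * vec_norm2 v))"
      by (intro mult_left_mono vec_norm2_mult_le_mat_norm2[OF b v p p] na0 less_imp_le[OF s])
    finally show "vec_norm2 (Y *\<^sub>v v) \<le> mat_norm2 a * ?s * mat_norm2 b * vec_norm2 v" by (simp add: mult_ac)
  qed (use na0 nb0 s in simp)
  then have "singular_value (1 + k * l) Y / ?s \<le> mat_norm2 a * mat_norm2 b"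
    using s by (simp add: field_simps)
  then have "ennreal (singular_value (1 + k * l) Y / ?s) \<le> ennreal (mat_norm2 a) * ennreal (mat_norm2 b)"
    using na0 nb0 by (metis ennreal_leI ennreal_mult)
  also have "\<dots> \<le> (crouzeix_constant * S) * (crouzeix_constant * inverse T)"
    by (rule mult_mono[OF na nb]) auto
  also have "\<dots> = crouzeix_constant\<^sup>2 * (S / T)"
    by (simp add: divide_ennreal_def power2_eq_square mult_ac)
  finally show ?thesis .
qed

section \<open>Positivity of Zolotarev numbers\<close>

text \<open>A polynomial of degree at most \<open>l\<close> is determined by its values at
  \<open>l + 1\<close> points, so its values elsewhere are controlled by the Lagrange basis
  \<open>b\<close>.\<close>

lemma lagrange_interpolation_bound:
  fixes X Z :: "complex set"
  assumes X: "finite X" "card X = Suc l" and Z: "finite Z"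
  obtains L where "0 < L"
    "\<And>p c y. degree p \<le> l \<Longrightarrow> (\<And>x. x \<in> X \<Longrightarrow> cmod (poly p x) \<le> c) \<Longrightarrow> y \<in> Z \<Longrightarrow> cmod (poly p y) \<le> L * c"
proof -
  define w where "w x = (\<Prod>x'\<in>X - {x}. x - x')" for x
  define b where "b x = smult (1 / w x) (\<Prod>x'\<in>X - {x}. [:-x', 1:])" for x
  have w: "w x \<noteq> 0" for x
    using X(1) by (auto simp: w_def)
  have db: "degree (b x) \<le> l" if "x \<in> X" for x
  proof -
    have "degree (b x) \<le> degree (\<Prod>x'\<in>X - {x}. [:-x', 1:])" unfolding b_def by (rule degree_smult_le)
    also have "\<dots> \<le> (\<Sum>x'\<in>X - {x}. 1)"
      using degree_prod_sum_le[of "X - {x}" "\<lambda>x'. [:-x', 1:]"] X(1) by simp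
    also have "\<dots> = l" using that X by simp
    finally show ?thesis .
  qed
  have bb: "poly (b x) x' = (if x = x' then 1 else 0)" if "x \<in> X" "x' \<in> X" for x x'
  proof (cases "x = x'")
    case True
    then show ?thesis using w[of x'] by (simp add: b_def poly_prod w_def[symmetric])
  next
    case False
    then have "(\<Prod>z\<in>X - {x}. poly [:-z, 1:] x') = 0"
      using that X(1) by (intro prod_zero) (auto intro!: bexI[of _ x'])
    then show ?thesis using False by (simp add: b_def poly_prod)
  qed
  \<comment> \<open>The sum over \<open>Z\<close> gives one constant for all its points; the summand
    1 makes it positive.\<close>
  define L where "L = 1 + (\<Sum>y\<in>Z. \<Sum>x\<in>X. cmod (poly (b x) y))"
  show thesis
  proof (rule that[of L])
    show "0 < L" unfolding L_def by (intro add_pos_nonneg sum_nonneg) auto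
  next
    fix p c y assume p: "degree p \<le> l" and c: "\<And>x. x \<in> X \<Longrightarrow> cmod (poly p x) \<le> c" and y: "y \<in> Z"
    obtain x0 where "x0 \<in> X" using X by (metis card.empty ex_in_conv nat.distinct(1))
    then have c0: "0 \<le> c" using c[of x0] norm_ge_zero order_trans by blast
    have "p = (\<Sum>x\<in>X. smult (poly p x) (b x))"
    proof (rule poly_eqI_degree[of X])
      fix z assume z: "z \<in> X"
      have "poly (\<Sum>x\<in>X. smult (poly p x) (b x)) z = (\<Sum>x\<in>X. if x = z then poly p x else 0)"
        unfolding poly_sum using z bb by (intro sum.cong) auto
      then show "poly p z = poly (\<Sum>x\<in>X. smult (poly p x) (b x)) z" using z X(1) by simp
    next
      have "degree (\<Sum>x\<in>X. smult (poly p x) (b x)) \<le> l"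
        using db by (intro degree_sum_le[OF X(1)] order_trans[OF degree_smult_le])
      then show "degree (\<Sum>x\<in>X. smult (poly p x) (b x)) < card X" using X by simp
    qed (use p X in auto)
    then have "poly p y = (\<Sum>x\<in>X. poly p x * poly (b x) y)"
      by (metis (no_types, lifting) poly_smult poly_sum sum.cong)
    then have "cmod (poly p y) \<le> (\<Sum>x\<in>X. cmod (poly p x) * cmod (poly (b x) y))"
      using norm_sum[of "\<lambda>x. poly p x * poly (b x) y" X] by (simp add: norm_mult)
    also have "\<dots> \<le> (\<Sum>x\<in>X. c * cmod (poly (b x) y))"
      using c by (intro sum_mono mult_right_mono) auto
    also have "\<dots> = c * (\<Sum>x\<in>X. cmod (poly (b x) y))" by (simp add: sum_distrib_left)
    also have "\<dots> \<le> c * L"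
    proof (rule mult_left_mono[OF _ c0])
      have "(\<Sum>x\<in>X. cmod (poly (b x) y)) \<le> (\<Sum>y\<in>Z. \<Sum>x\<in>X. cmod (poly (b x) y))"
        using y Z by (intro member_le_sum[of y Z "\<lambda>y. \<Sum>x\<in>X. cmod (poly (b x) y)"]) (auto intro: sum_nonneg)
      then show "(\<Sum>x\<in>X. cmod (poly (b x) y)) \<le> L" by (simp add: L_def)
    qed
    finally show "cmod (poly p y) \<le> L * c" by (simp add: mult.commute)
  qed
qed

text \<open>Controlling \<open>p\<close> on \<open>F\<close> by its values at \<open>l + 1\<close> points of \<open>E\<close>, and \<open>q\<close> on \<open>E\<close> by its values at
  \<open>l + 1\<close> points of \<open>F\<close>, bounds every admissible quotient from below.\<close>

lemma zolotarev_pos: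
  assumes infE: "infinite E" and infF: "infinite F"
  shows "0 < zolotarev l E F"
proof -
  obtain X where X: "X \<subseteq> E" "finite X" "card X = Suc l"
    using infinite_arbitrarily_large[OF infE] by blast
  obtain Z where Z: "Z \<subseteq> F" "finite Z" "card Z = Suc l"
    using infinite_arbitrarily_large[OF infF] by blast
  obtain L where L: "0 < L" "\<And>p c y. degree p \<le> l \<Longrightarrow> (\<And>x. x \<in> X \<Longrightarrow> cmod (poly p x) \<le> c) \<Longrightarrow> y \<in> Z \<Longrightarrow> cmod (poly p y) \<le> L * c"
    using lagrange_interpolation_bound[OF X(2,3) Z(2)] by blast
  obtain L' where L': "0 < L'" "\<And>p c y. degree p \<le> l \<Longrightarrow> (\<And>x. x \<in> Z \<Longrightarrow> cmod (poly p x) \<le> c) \<Longrightarrow> y \<in> X \<Longrightarrow> cmod (poly p y) \<le> L' * c"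
    using lagrange_interpolation_bound[OF Z(2,3) X(2)] by blast
  have "ennreal (1 / (L * L')) \<le> zolotarev l E F"
    unfolding zolotarev_def
  proof (rule Inf_greatest, elim CollectE exE conjE)
    fix r p q S T
    assume r: "r = S / T" and dp: "degree p \<le> l" and dq: "degree q \<le> l" and "q \<noteq> 0" and cop: "coprime p q"
      and S: "S = (SUP x\<in>E. ratfun_abs p q x)" and T: "T = (INF y\<in>F. ratfun_abs p q y)"
      and n0: "\<not> (S = 0 \<and> T = 0)" and ninf: "\<not> (S = \<infinity> \<and> T = \<infinity>)"
    show "ennreal (1 / (L * L')) \<le> r"
    proof (cases "T = 0 \<or> S = \<infinity>")
      case True
      then have "r = \<infinity>" using n0 ninf unfolding r by (auto simp: ennreal_divide_eq_top_iff)
      then show ?thesis by simp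
    next
      case False
      have Sx: "ratfun_abs p q x \<le> S" if "x \<in> E" for x using S that by (auto intro: SUP_upper)
      have Tx: "T \<le> ratfun_abs p q y" if "y \<in> F" for y using T that by (auto intro: INF_lower)
      obtain s where s: "S = ennreal s" "0 \<le> s" using False by (cases S) auto
      \<comment> \<open>\<open>T\<close> may be infinite, but its inverse is a real number.\<close>
      have "inverse T \<noteq> \<infinity>" using False by simp
      then obtain t where t: "inverse T = ennreal t" "0 \<le> t" by (cases "inverse T") auto
      have qE: "poly q x \<noteq> 0" "cmod (poly p x) \<le> s * cmod (poly q x)" if "x \<in> E" for x
      proof -
        show q0: "poly q x \<noteq> 0" using Sx[OF that] s by (auto simp: ratfun_abs_def top_unique)
        have "cmod (poly p x / poly q x) \<le> s"
          using Sx[OF that] s q0 by (simp add: ratfun_abs_def)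
        then show "cmod (poly p x) \<le> s * cmod (poly q x)"
          using q0 by (simp add: norm_divide divide_le_eq)
      qed
      have pF: "poly p y \<noteq> 0" "cmod (poly q y) \<le> t * cmod (poly p y)" if "y \<in> F" for y
      proof -
        show p0: "poly p y \<noteq> 0"
        proof
          assume 0: "poly p y = 0"
          have "poly q y \<noteq> 0" using cop 0 by (metis coprime_poly_0)
          then show False using Tx[OF that] 0 False by (simp add: ratfun_abs_def)
        qed
        have "ennreal (cmod (poly q y / poly p y)) = inverse (ratfun_abs p q y)"
          using p0 by (auto simp: ratfun_abs_def inverse_ennreal norm_divide)
        also have "\<dots> \<le> ennreal t" unfolding t(1)[symmetric] by (rule ennreal_inverse_antimono[OF Tx[OF that]])
        finally have "cmod (poly q y / poly p y) \<le> t" using t(2) by (simp add: ennreal_le_iff)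
        then show "cmod (poly q y) \<le> t * cmod (poly p y)"
          using p0 by (simp add: norm_divide divide_le_eq)
      qed
      define P where "P = Max ((\<lambda>x. cmod (poly p x)) ` X)"
      define Q where "Q = Max ((\<lambda>x. cmod (poly q x)) ` Z)"
      have XN: "X \<noteq> {}" and ZN: "Z \<noteq> {}" using X Z by auto
      have P: "cmod (poly p x) \<le> P" if "x \<in> X" for x unfolding P_def using X that by auto
      have Q: "cmod (poly q y) \<le> Q" if "y \<in> Z" for y unfolding Q_def using Z that by auto
      \<comment> \<open>Otherwise \<open>p\<close> would have more zeros than its degree allows and
        vanish identically, although it has no zero in \<open>F\<close>.\<close>
      have "\<exists>x\<in>X. poly p x \<noteq> 0"
      proof (rule ccontr)
        assume "\<not> ?thesis"
        then have "p = 0" by (intro poly_eqI_degree[of X]) (use X dp in auto)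
        then show False using pF(1) ZN Z(1) by auto
      qed
      then obtain x1 where "x1 \<in> X" "poly p x1 \<noteq> 0" by blast
      then have P0: "0 < P" using P[of x1] by (metis norm_ge_zero less_le_trans zero_less_norm_iff)
      have "P \<in> (\<lambda>x. cmod (poly p x)) ` X" unfolding P_def using X XN by (intro Max_in) auto
      then obtain x2 where x2: "x2 \<in> X" "P = cmod (poly p x2)" by auto
      have "Q \<in> (\<lambda>x. cmod (poly q x)) ` Z" unfolding Q_def using Z ZN by (intro Max_in) auto
      then obtain y2 where y2: "y2 \<in> Z" "Q = cmod (poly q y2)" by auto
      \<comment> \<open>A closed cycle of estimates: from \<open>p\<close> to \<open>q\<close> on
        \<open>E\<close>, over to \<open>Z\<close>, from \<open>q\<close> to \<open>p\<close> on
        \<open>F\<close>, and back to \<open>X\<close>. Cancelling \<open>P\<close> leaves a lower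
        bound for \<open>s * t\<close>.\<close>
      have "P \<le> s * cmod (poly q x2)" using qE(2)[of x2] x2 X by auto
      also have "\<dots> \<le> s * (L' * Q)"
        by (intro mult_left_mono L'(2)[OF dq Q x2(1)] s(2))
      also have "\<dots> \<le> s * (L' * (t * cmod (poly p y2)))"
        using pF(2)[of y2] y2 Z s L' by (intro mult_left_mono) auto
      also have "\<dots> \<le> s * (L' * (t * (L * P)))"
        using L'(1) by (intro mult_left_mono L(2)[OF dp P y2(1)] s(2) t(2)) auto
      finally have "P * 1 \<le> P * (s * t * (L * L'))" by (simp add: mult_ac)
      then have "1 \<le> s * t * (L * L')" using P0 by (simp only: mult_le_cancel_left_pos)
      then have "1 / (L * L') \<le> s * t" using L(1) L'(1) by (simp add: divide_le_eq)
      then have "ennreal (1 / (L * L')) \<le> ennreal (s * t)" by (rule ennreal_leI)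
      also have "\<dots> = S * inverse T" using s t by (simp add: ennreal_mult)
      finally show ?thesis unfolding r by (simp add: divide_ennreal_def)
    qed
  qed
  moreover have "0 < ennreal (1 / (L * L'))" using L(1) L'(1) by simp
  ultimately show ?thesis by (rule less_le_trans[rotated])
qed

section \<open>Matrices with finite field of values\<close>

lemma cscalar_quadratic_expand:
  fixes A :: "complex mat"
  assumes A: "A \<in> carrier_mat n n" and v: "v \<in> carrier_vec n" and u: "u \<in> carrier_vec n"
  shows "(A *\<^sub>v (v + c \<cdot>\<^sub>v u)) \<bullet>c (v + c \<cdot>\<^sub>v u)
    = (A *\<^sub>v v) \<bullet>c v + cnj c * ((A *\<^sub>v v) \<bullet>c u) + c * ((A *\<^sub>v u) \<bullet>c v) + c * cnj c * ((A *\<^sub>v u) \<bullet>c u)"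
proof -
  have cu: "c \<cdot>\<^sub>v u \<in> carrier_vec n" using u by simp
  have vcu: "v + c \<cdot>\<^sub>v u \<in> carrier_vec n" using v cu by simp
  have eq: "A *\<^sub>v (v + c \<cdot>\<^sub>v u) = A *\<^sub>v v + c \<cdot>\<^sub>v (A *\<^sub>v u)"
    unfolding mult_add_distrib_mat_vec[OF A v cu] mult_mat_vec[OF A u] ..
  have "A *\<^sub>v v \<in> carrier_vec n" "A *\<^sub>v u \<in> carrier_vec n" using A v u by auto
  then show ?thesis
    unfolding eq cscalar_prod_sum[OF vcu] cscalar_prod_sum[OF v] cscalar_prod_sum[OF u]
    unfolding sum_distrib_left sum.distrib[symmetric]
    using A v u by (intro sum.cong) (auto simp: ring_distribs mult_ac simp del: index_mult_mat_vec)
qed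

lemma cscalar_unit_vec:
  fixes A :: "complex mat"
  assumes A: "A \<in> carrier_mat n n" and ij: "i < n" "j < n"
  shows "(A *\<^sub>v unit_vec n i) \<bullet>c unit_vec n j = A $$ (j, i)"
proof -
  have "(A *\<^sub>v unit_vec n i) \<bullet>c unit_vec n j = (\<Sum>k<n. if k = j then A $$ (k, i) else 0)"
    unfolding cscalar_prod_sum[OF unit_vec_carrier] using A ij by (intro sum.cong) auto
  then show ?thesis using ij by simp
qed

text \<open>Along the segment from \<open>e\<^sub>i\<close> to \<open>e\<^sub>i + c e\<^sub>j\<close> the Rayleigh quotient is continuous, so if it
  takes finitely many values it is constant.\<close>

lemma finite_field_of_values_line:
  assumes A: "A \<in> carrier_mat n n" and fin: "finite (field_of_values A)" and ij: "i < n" "j < n" "i \<noteq> j"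
  shows "cnj c * A $$ (j, i) + c * A $$ (i, j) + c * cnj c * A $$ (j, j) = c * cnj c * A $$ (i, i)"
proof -
  let ?e = "unit_vec n i" and ?u = "unit_vec n j"
  note unit = cscalar_unit_vec
  define x where "x t = ?e + (complex_of_real t * c) \<cdot>\<^sub>v ?u" for t
  define N where "N t = A $$ (i, i) + cnj (complex_of_real t * c) * A $$ (j, i) + (complex_of_real t * c) * A $$ (i, j)
    + (complex_of_real t * c) * cnj (complex_of_real t * c) * A $$ (j, j)" for t
  define D where "D t = 1 + (complex_of_real t * c) * cnj (complex_of_real t * c)" for t
  have x: "x t \<in> carrier_vec n" for t by (simp add: x_def)
  have N: "(A *\<^sub>v x t) \<bullet>c x t = N t" for t
    unfolding x_def N_def cscalar_quadratic_expand[OF A unit_vec_carrier unit_vec_carrier]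
    using unit[OF A] ij by simp
  \<comment> \<open>The denominator is the same quadratic form for the identity matrix.\<close>
  have D: "x t \<bullet>c x t = D t" for t
    using cscalar_quadratic_expand[OF one_carrier_mat unit_vec_carrier unit_vec_carrier, of n i "complex_of_real t * c" j]
      unit[OF one_carrier_mat, of _ n] ij x[of t]
    unfolding x_def D_def by simp
  have D0: "D t \<noteq> 0" for t
  proof -
    have "D t = complex_of_real (1 + (cmod (complex_of_real t * c))\<^sup>2)"
      unfolding D_def of_real_add complex_norm_square by simp
    moreover have "1 + (cmod (complex_of_real t * c))\<^sup>2 \<noteq> 0" by (simp add: add_nonneg_eq_0_iff)
    ultimately show ?thesis by (simp only: of_real_eq_0_iff not_False_eq_True)
  qed
  have x0: "x t \<noteq> 0\<^sub>v n" for t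
    using D0[of t] D[of t] conjugate_square_eq_0_vec[OF x[of t]] by simp
  let ?f = "\<lambda>t. N t / D t"
  have "?f ` {0..1} \<subseteq> field_of_values A"
    using field_of_valuesI[OF A x x0] unfolding N D by auto
  then have "finite (?f ` {0..1})" using fin finite_subset by blast
  moreover have "connected (?f ` {0..1})"
    using D0 by (intro connected_continuous_image) (auto simp: N_def D_def intro!: continuous_intros)
  ultimately obtain a where a: "?f ` {0..1} \<subseteq> {a}"
    by (auto simp: connected_finite_iff_sing)
  have "?f 1 = a" "?f 0 = a" using subsetD[OF a imageI, of 1] subsetD[OF a imageI, of 0] by auto
  then have "?f 1 = ?f 0" by simp
  then have "N 1 = A $$ (i, i) * D 1" using D0[of 1] by (simp add: N_def D_def field_simps)
  then show ?thesis by (simp add: N_def D_def algebra_simps)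
qed

text \<open>Polarization: \<open>c = 1\<close> and \<open>c = -1\<close> together equate the
  diagonal entries and give opposite off-diagonal entries, while \<open>c = \<i>\<close> makes the
  latter equal, hence 0.\<close>

lemma finite_field_of_values_imp_scalar:
  assumes A: "A \<in> carrier_mat n n" and n: "0 < n" and fin: "finite (field_of_values A)"
  obtains a where "a \<in> field_of_values A" "A = a \<cdot>\<^sub>m 1\<^sub>m n"
proof -
  note line = finite_field_of_values_line[OF A fin]
  have e: "A $$ (j, j) = A $$ (i, i) \<and> A $$ (i, j) = 0" if ij: "i < n" "j < n" "i \<noteq> j" for i j
  proof -
    have 1: "A $$ (j, i) + A $$ (i, j) + A $$ (j, j) = A $$ (i, i)"
      using line[OF ij, of 1] by simp
    have 2: "- A $$ (j, i) - A $$ (i, j) + A $$ (j, j) = A $$ (i, i)"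
      using line[OF ij, of "-1"] by simp
    have 3: "\<i> * (A $$ (i, j) - A $$ (j, i)) + A $$ (j, j) = A $$ (i, i)"
      using line[OF ij, of \<i>] by (simp add: algebra_simps)
    have d: "A $$ (j, j) = A $$ (i, i)"
    proof -
      have "2 * A $$ (j, j) = 2 * A $$ (i, i)" using arg_cong2[OF 1 2, of "(+)"] by (simp add: algebra_simps)
      then show ?thesis by simp
    qed
    have "A $$ (i, j) = A $$ (j, i)" using 3 d by simp
    moreover have "A $$ (j, i) + A $$ (i, j) = 0" using 1 d by simp
    ultimately show ?thesis using d by simp
  qed
  have d: "A $$ (i, i) = A $$ (0, 0)" if "i < n" for i
    using e[of 0 i] that n by (cases "i = 0") auto
  show thesis
  proof (rule that)
    have "unit_vec n 0 \<bullet>c unit_vec n 0 = (1 :: complex)"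
      using cscalar_unit_vec[OF one_carrier_mat n n] n by simp
    then show "A $$ (0, 0) \<in> field_of_values A"
      using field_of_valuesI[OF A unit_vec_carrier, of 0] cscalar_unit_vec[OF A n n] n by simp
    show "A = A $$ (0, 0) \<cdot>\<^sub>m 1\<^sub>m n"
    proof (rule eq_matI)
      fix i j assume "i < dim_row (A $$ (0, 0) \<cdot>\<^sub>m 1\<^sub>m n)" "j < dim_col (A $$ (0, 0) \<cdot>\<^sub>m 1\<^sub>m n)"
      then have "i < n" "j < n" by auto
      then show "A $$ (i, j) = (A $$ (0, 0) \<cdot>\<^sub>m 1\<^sub>m n) $$ (i, j)"
        using d[of i] e[of i j] by (cases "i = j") simp_all
    qed (use A in auto)
  qed
qed

section \<open>Low-rank solutions when one coefficient is scalar\<close>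

lemma singular_value_nonpos_of_rank_le:
  assumes Y: "Y \<in> carrier_mat m p" and r: "rank_le r Y"
  shows "singular_value (1 + r) Y \<le> 0"
proof -
  obtain U V where U: "U \<in> carrier_mat m r" and V: "V \<in> carrier_mat r p" and UV: "Y = U * V"
    using rank_leE[OF r Y] .
  show ?thesis
  proof (rule singular_value_le[OF Y V])
    fix x :: "complex Matrix.vec" assume x: "x \<in> carrier_vec p" and Vx: "V *\<^sub>v x = 0\<^sub>v r"
    have "Y *\<^sub>v x = 0\<^sub>v m"
      unfolding UV assoc_mult_mat_vec[OF U V x] Vx using U by (intro eq_vecI) auto
    then show "vec_norm2 (Y *\<^sub>v x) \<le> 0 * vec_norm2 x"
      using vec_norm2_eq_0_iff[of "0\<^sub>v m" m] by simp
  qed simp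
qed

text \<open>The left-hand side is \<open>Y\<close> times (a I - D), and this factor is invertible
  because \<open>a\<close> is not an eigenvalue of \<open>D\<close>. Multiplying by its inverse
  preserves the rank bound.\<close>

lemma rank_le_sylvester_scalar_left:
  fixes D Y :: "complex mat"
  assumes D: "D \<in> carrier_mat p p" and Y: "Y \<in> carrier_mat m p"
    and G: "rank_le k ((a \<cdot>\<^sub>m 1\<^sub>m m) * Y - Y * D)" and a: "a \<notin> field_of_values D"
  shows "rank_le k Y"
proof -
  let ?Q = "[:a, -1:]"
  have "poly ?Q z \<noteq> 0" if "poly (char_poly D) z = 0" for z
    using root_char_poly_in_field_of_values[OF D that] a by auto
  then obtain x where "poly_of_mat x D * poly_of_mat ?Q D = 1\<^sub>m p"
    using poly_of_mat_left_inverse[OF D] by blast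
  then have x: "poly_of_mat ?Q D * poly_of_mat x D = 1\<^sub>m p" by (simp add: poly_of_mat_commute[OF D])
  have G': "(a \<cdot>\<^sub>m 1\<^sub>m m) * Y - Y * D \<in> carrier_mat m p" using Y D by (intro minus_carrier_mat) auto
  have "(a \<cdot>\<^sub>m 1\<^sub>m m) * Y - Y * D = Y * poly_of_mat ?Q D"
  proof -
    have "Y * poly_of_mat ?Q D = Y * (a \<cdot>\<^sub>m 1\<^sub>m p) + Y * ((-1) \<cdot>\<^sub>m D)"
      unfolding poly_of_mat_linear[OF D] by (rule mult_add_distrib_mat[OF Y]) (use D in auto)
    also have "\<dots> = a \<cdot>\<^sub>m Y + (-1) \<cdot>\<^sub>m (Y * D)"
      unfolding mult_smult_distrib[OF Y one_carrier_mat] mult_smult_distrib[OF Y D] right_mult_one_mat[OF Y] ..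
    also have "\<dots> = a \<cdot>\<^sub>m Y - Y * D" using Y D by (intro eq_matI) auto
    finally show ?thesis
      unfolding mult_smult_assoc_mat[OF one_carrier_mat Y] left_mult_one_mat[OF Y] by simp
  qed
  then have "((a \<cdot>\<^sub>m 1\<^sub>m m) * Y - Y * D) * poly_of_mat x D = Y"
    using assoc_mult_mat[OF Y poly_of_mat_carrier[OF D] poly_of_mat_carrier[OF D], of ?Q x] right_mult_one_mat[OF Y]
    by (simp only: x)
  then show ?thesis using rank_le_mult_right[OF G' poly_of_mat_carrier[OF D] G, of x] by simp
qed

lemma rank_le_sylvester_scalar_right:
  fixes A Y :: "complex mat"
  assumes A: "A \<in> carrier_mat m m" and Y: "Y \<in> carrier_mat m p"
    and G: "rank_le k (A * Y - Y * (d \<cdot>\<^sub>m 1\<^sub>m p))" and d: "d \<notin> field_of_values A"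
  shows "rank_le k Y"
proof -
  let ?Q = "[:-d, 1:]"
  have "poly ?Q z \<noteq> 0" if "poly (char_poly A) z = 0" for z
    using root_char_poly_in_field_of_values[OF A that] d by auto
  then obtain x where x: "poly_of_mat x A * poly_of_mat ?Q A = 1\<^sub>m m"
    using poly_of_mat_left_inverse[OF A] by blast
  have G': "A * Y - Y * (d \<cdot>\<^sub>m 1\<^sub>m p) \<in> carrier_mat m p" using Y A by (intro minus_carrier_mat) auto
  have "A * Y - Y * (d \<cdot>\<^sub>m 1\<^sub>m p) = poly_of_mat ?Q A * Y"
  proof -
    have "poly_of_mat ?Q A * Y = ((-d) \<cdot>\<^sub>m 1\<^sub>m m) * Y + (1 \<cdot>\<^sub>m A) * Y"
      unfolding poly_of_mat_linear[OF A] by (rule add_mult_distrib_mat[OF _ _ Y]) (use A in auto)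
    also have "\<dots> = (-d) \<cdot>\<^sub>m Y + 1 \<cdot>\<^sub>m (A * Y)"
      unfolding mult_smult_assoc_mat[OF one_carrier_mat Y] mult_smult_assoc_mat[OF A Y] left_mult_one_mat[OF Y] ..
    also have "\<dots> = A * Y - d \<cdot>\<^sub>m Y" using Y A by (intro eq_matI) auto
    finally show ?thesis
      unfolding mult_smult_distrib[OF Y one_carrier_mat] right_mult_one_mat[OF Y] by simp
  qed
  then have "poly_of_mat x A * (A * Y - Y * (d \<cdot>\<^sub>m 1\<^sub>m p)) = Y"
    using assoc_mult_mat[OF poly_of_mat_carrier[OF A] poly_of_mat_carrier[OF A] Y, of x ?Q] left_mult_one_mat[OF Y]
    by (simp only: x)
  then show ?thesis using rank_le_mult_left[OF poly_of_mat_carrier[OF A] G' G, of x] by simp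
qed

text \<open>Both conditions on \<open>c\<close> matter: for infinite \<open>c\<close> the set of
  positive reals, with infimum 0, is a counterexample, and for \<open>c = 0\<close> the empty set is
  one.\<close>

lemma ennreal_le_mult_Inf:
  fixes c :: ennreal
  assumes "\<And>r. r \<in> K \<Longrightarrow> a \<le> c * r" and c: "c \<noteq> 0" "c \<noteq> \<infinity>"
  shows "a \<le> c * Inf K"
proof -
  have "a / c \<le> Inf K"
    using assms(1) c by (intro Inf_greatest divide_le_posI_ennreal) (auto simp: zero_less_iff_neq_zero)
  then have "c * (a / c) \<le> c * Inf K" by (rule mult_left_mono) simp
  moreover have "c * (a / c) = a"
    unfolding ennreal_times_divide mult.commute[of c] using c by (simp add: ennreal_mult_divide_eq)
  ultimately show ?thesis by simp
qed

theorem sylvester_singular_value_ratio: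
  fixes A D Y :: "complex mat"
  assumes A: "A \<in> carrier_mat m m" and D: "D \<in> carrier_mat p p" and Y: "Y \<in> carrier_mat m p"
    and m: "0 < m" and p: "0 < p" and Y0: "Y \<noteq> 0\<^sub>m m p"
    and G: "rank_le k (A * Y - Y * D)" and l: "1 \<le> l"
    and EF: "E \<inter> F = {}" and AE: "field_of_values A \<subseteq> E" and DF: "field_of_values D \<subseteq> F"
  shows "ennreal (singular_value (1 + k * l) Y / singular_value 1 Y) \<le> crouzeix_constant\<^sup>2 * zolotarev l E F"
proof (cases "crouzeix_constant = \<infinity>")
  case False
  have c1: "1 \<le> crouzeix_constant\<^sup>2" using one_le_crouzeix_constant by (rule one_le_power)
  show ?thesis
    unfolding zolotarev_def
  proof (rule ennreal_le_mult_Inf, elim CollectE exE conjE)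
    show "crouzeix_constant\<^sup>2 \<noteq> 0" using c1 by auto
    show "crouzeix_constant\<^sup>2 \<noteq> \<infinity>" using False by (simp add: power_eq_top_ennreal)
    fix r P Q S T
    assume r: "r = S / T" and deg: "degree P \<le> l" "degree Q \<le> l" and cop: "coprime P Q"
      and S: "S = (SUP x\<in>E. ratfun_abs P Q x)" and T: "T = (INF y\<in>F. ratfun_abs P Q y)"
      and n0: "\<not> (S = 0 \<and> T = 0)" and ninf: "\<not> (S = \<infinity> \<and> T = \<infinity>)"
    show "ennreal (singular_value (1 + k * l) Y / singular_value 1 Y) \<le> crouzeix_constant\<^sup>2 * r"
    proof (cases "T = 0 \<or> S = \<infinity>")
      case True
      \<comment> \<open>The indeterminate quotients being excluded, this one is infinite and the
        bound is trivial.\<close>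
      then have "r = \<infinity>" using n0 ninf unfolding r by (auto simp: ennreal_divide_eq_top_iff)
      then have "crouzeix_constant\<^sup>2 * r = \<infinity>" using c1 by (auto simp: ennreal_mult_eq_top_iff)
      then show ?thesis by simp
    next
      case F: False
      show ?thesis
        unfolding r using F
        by (intro singular_value_ratio_le_rational[OF A D Y m p Y0 G deg cop AE DF False S _ T]) auto
    qed
  qed
next
  case True
  show ?thesis
  proof (cases "infinite E \<and> infinite F")
    case inf: True
    then have "0 < zolotarev l E F" by (intro zolotarev_pos) auto
    then have "crouzeix_constant\<^sup>2 * zolotarev l E F = \<infinity>"
      unfolding True by (auto simp: ennreal_mult_eq_top_iff power_eq_top_ennreal)
    then show ?thesis by simp
  next
    case fin: False
    \<comment> \<open>A finite \<open>E\<close> or \<open>F\<close> makes \<open>A\<close> or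
      \<open>D\<close> scalar, and disjointness keeps that scalar out of the other field of
      values.\<close>
    have "rank_le k Y"
    proof (cases "finite E")
      case True
      then have "finite (field_of_values A)" using AE finite_subset by blast
      then obtain a where a: "a \<in> field_of_values A" "A = a \<cdot>\<^sub>m 1\<^sub>m m"
        using finite_field_of_values_imp_scalar[OF A m] by blast
      then show ?thesis
        using rank_le_sylvester_scalar_left[OF D Y, of k a] G AE DF EF by blast
    next
      case False
      then have "finite (field_of_values D)" using fin DF finite_subset by blast
      then obtain d where d: "d \<in> field_of_values D" "D = d \<cdot>\<^sub>m 1\<^sub>m p"
        using finite_field_of_values_imp_scalar[OF D p] by blast
      then show ?thesis
        using rank_le_sylvester_scalar_right[OF A Y, of k d] G AE DF EF by blast
    qed
    then have "rank_le (k * l) Y" by (rule rank_le_mono) (use l in simp)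
    then have "singular_value (1 + k * l) Y \<le> 0" by (rule singular_value_nonpos_of_rank_le[OF Y])
    then have "singular_value (1 + k * l) Y / singular_value 1 Y \<le> 0"
      using singular_value_1_pos[OF Y m p Y0] by (intro divide_nonpos_pos)
    then have "ennreal (singular_value (1 + k * l) Y / singular_value 1 Y) = 0" by (rule ennreal_neg)
    then show ?thesis by simp
  qed
qed

section \<open>Off-diagonal blocks\<close>

lemma conjugate_append_vec:
  "conjugate (v @\<^sub>v w) = conjugate v @\<^sub>v conjugate (w :: 'a :: conjugatable_ring Matrix.vec)"
  by (intro eq_vecI) auto

text \<open>Padding a vector with zeros changes neither the quadratic form nor the norm, so Rayleigh
  quotients of a diagonal block are Rayleigh quotients of the whole matrix.\<close>

lemma field_of_values_diagonal_blocks: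
  fixes A1 A2 A3 A4 :: "complex mat"
  assumes A1: "A1 \<in> carrier_mat p p" and A2: "A2 \<in> carrier_mat p q"
    and A3: "A3 \<in> carrier_mat q p" and A4: "A4 \<in> carrier_mat q q"
  shows "field_of_values A1 \<subseteq> field_of_values (four_block_mat A1 A2 A3 A4)"
    "field_of_values A4 \<subseteq> field_of_values (four_block_mat A1 A2 A3 A4)"
proof -
  let ?M = "four_block_mat A1 A2 A3 A4"
  have M: "?M \<in> carrier_mat (p + q) (p + q)" using A1 A4 by (rule four_block_carrier_mat)
  have form: "(?M *\<^sub>v (x @\<^sub>v y)) \<bullet>c (x @\<^sub>v y) = (A1 *\<^sub>v x + A2 *\<^sub>v y) \<bullet>c x + (A3 *\<^sub>v x + A4 *\<^sub>v y) \<bullet>c y"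
    and self: "(x @\<^sub>v y) \<bullet>c (x @\<^sub>v y) = x \<bullet>c x + y \<bullet>c y"
    if "x \<in> carrier_vec p" "y \<in> carrier_vec q" for x y
    unfolding four_block_mat_mult_vec[OF assms that] conjugate_append_vec
    by (rule scalar_prod_append[of _ p _ q]; use assms that in auto)+
  have z: "A2 *\<^sub>v 0\<^sub>v q = 0\<^sub>v p" "A3 *\<^sub>v 0\<^sub>v p = 0\<^sub>v q"
    using A2 A3 by (auto intro!: eq_vecI)
  have z14: "A1 *\<^sub>v 0\<^sub>v p = 0\<^sub>v p" "A4 *\<^sub>v 0\<^sub>v q = 0\<^sub>v q"
    using A1 A4 by (auto intro!: eq_vecI)
  show "field_of_values A1 \<subseteq> field_of_values ?M"
  proof
    fix w assume "w \<in> field_of_values A1"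
    then obtain x where x: "x \<in> carrier_vec p" "x \<noteq> 0\<^sub>v p" and w: "w = ((A1 *\<^sub>v x) \<bullet>c x) / (x \<bullet>c x)"
      using A1 by (auto simp: field_of_values_def)
    have y: "0\<^sub>v q \<in> carrier_vec q" by simp
    have Ax: "A1 *\<^sub>v x \<in> carrier_vec p" using A1 x(1) by simp
    have Ax3: "A3 *\<^sub>v x \<in> carrier_vec q" using A3 x(1) by simp
    have "x \<bullet>c x \<noteq> 0" using x conjugate_square_eq_0_vec[OF x(1)] by simp
    then have "(x @\<^sub>v 0\<^sub>v q) \<bullet>c (x @\<^sub>v 0\<^sub>v q) \<noteq> 0" unfolding self[OF x(1) y] by simp
    then have "x @\<^sub>v 0\<^sub>v q \<noteq> 0\<^sub>v (p + q)" by auto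
    then have "((?M *\<^sub>v (x @\<^sub>v 0\<^sub>v q)) \<bullet>c (x @\<^sub>v 0\<^sub>v q)) / ((x @\<^sub>v 0\<^sub>v q) \<bullet>c (x @\<^sub>v 0\<^sub>v q)) \<in> field_of_values ?M"
      using x(1) by (intro field_of_valuesI[OF M]) auto
    then show "w \<in> field_of_values ?M"
      unfolding form[OF x(1) y] self[OF x(1) y] z z14 w using Ax Ax3 by simp
  qed
  show "field_of_values A4 \<subseteq> field_of_values ?M"
  proof
    fix w assume "w \<in> field_of_values A4"
    then obtain x where x: "x \<in> carrier_vec q" "x \<noteq> 0\<^sub>v q" and w: "w = ((A4 *\<^sub>v x) \<bullet>c x) / (x \<bullet>c x)"
      using A4 by (auto simp: field_of_values_def)
    have y: "0\<^sub>v p \<in> carrier_vec p" by simp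
    have Ax: "A4 *\<^sub>v x \<in> carrier_vec q" using A4 x(1) by simp
    have Ax2: "A2 *\<^sub>v x \<in> carrier_vec p" using A2 x(1) by simp
    have "x \<bullet>c x \<noteq> 0" using x conjugate_square_eq_0_vec[OF x(1)] by simp
    then have "(0\<^sub>v p @\<^sub>v x) \<bullet>c (0\<^sub>v p @\<^sub>v x) \<noteq> 0" unfolding self[OF y x(1)] by simp
    then have "0\<^sub>v p @\<^sub>v x \<noteq> 0\<^sub>v (p + q)" by auto
    then have "((?M *\<^sub>v (0\<^sub>v p @\<^sub>v x)) \<bullet>c (0\<^sub>v p @\<^sub>v x)) / ((0\<^sub>v p @\<^sub>v x) \<bullet>c (0\<^sub>v p @\<^sub>v x)) \<in> field_of_values ?M"
      using x(1) by (intro field_of_valuesI[OF M]) auto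
    then show "w \<in> field_of_values ?M"
      unfolding form[OF y x(1)] self[OF y x(1)] z z14 w using Ax Ax2 by simp
  qed
qed

lemma pick_atLeastLessThan: "i < b - a \<Longrightarrow> pick {a..<b} i = a + i"
proof -
  assume i: "i < b - a"
  have "{x \<in> {a..<b}. x < a + i} = {a..<a + i}" using i by auto
  then show ?thesis using pick_card_in_set[of "a + i" "{a..<b}"] i by simp
qed

lemma rank_le_quasiseparable:
  assumes A: "A \<in> carrier_mat n n"
    and I: "I \<subseteq> {..<n}" "J \<subseteq> {..<n}" "(\<forall>i\<in>I. \<forall>j\<in>J. i < j) \<or> (\<forall>i\<in>I. \<forall>j\<in>J. j < i)"
  shows "rank_le (quasiseparable_rank A) (submatrix A I J)"
proof -
  let ?R = "\<lambda>I J. vec_space.rank (dim_row (submatrix A I J)) (submatrix A I J)"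
  let ?K = "{?R I J | I J. I \<subseteq> {..<dim_row A} \<and> J \<subseteq> {..<dim_col A} \<and>
            ((\<forall>i\<in>I. \<forall>j\<in>J. i < j) \<or> (\<forall>i\<in>I. \<forall>j\<in>J. j < i))}"
  have "?K \<subseteq> (\<lambda>(I, J). ?R I J) ` (Pow {..<dim_row A} \<times> Pow {..<dim_col A})" by auto
  then have "finite ?K" by (rule finite_subset) auto
  moreover have "?R I J \<in> ?K" using A I by auto
  ultimately have "?R I J \<le> quasiseparable_rank A"
    unfolding quasiseparable_rank_def by (rule Max_ge)
  moreover have "rank_le (?R I J) (submatrix A I J)"
    by (rule rank_le_rank[OF carrier_mat_triv])
  ultimately show ?thesis by (rule rank_le_mono[rotated])
qed

text \<open>The blocks are submatrices on the intervals below and from \<open>p\<close>, which lie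
  strictly on one side of the diagonal and hence compete in the maximum.\<close>

lemma rank_le_off_diagonal_blocks:
  assumes A: "A \<in> carrier_mat n n" and p: "p \<le> n"
    and split: "split_block A p p = (A11, A12, A21, A22)"
  shows "rank_le (quasiseparable_rank A) A12" "rank_le (quasiseparable_rank A) A21"
proof -
  have c: "card {i. i < n \<and> p \<le> i} = n - p" "card {i. i < n \<and> i < p} = p"
  proof -
    have "{i. i < n \<and> p \<le> i} = {p..<n}" "{i. i < n \<and> i < p} = {0..<p}" using p by auto
    then show "card {i. i < n \<and> p \<le> i} = n - p" "card {i. i < n \<and> i < p} = p" by simp_all
  qed
  have s: "A12 = Matrix.mat p (n - p) (\<lambda>(i, j). A $$ (i, j + p))" "A21 = Matrix.mat (n - p) p (\<lambda>(i, j). A $$ (i + p, j))"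
    using split A by (auto simp: split_block_def Let_def)
  have "submatrix A {0..<p} {p..<n} = A12"
    using A c p unfolding s submatrix_def
    by (intro eq_matI) (auto simp: pick_atLeastLessThan add.commute conj_commute cong: conj_cong)
  then show "rank_le (quasiseparable_rank A) A12"
    using rank_le_quasiseparable[OF A, of "{0..<p}" "{p..<n}"] p by force
  have "submatrix A {p..<n} {0..<p} = A21"
    using A c p unfolding s submatrix_def
    by (intro eq_matI) (auto simp: pick_atLeastLessThan add.commute conj_commute cong: conj_cong)
  then show "rank_le (quasiseparable_rank A) A21"
    using rank_le_quasiseparable[OF A, of "{p..<n}" "{0..<p}"] p by force
qed

lemma four_block_mat_inject_off_diagonal:
  assumes A: "A1 \<in> carrier_mat p p'" "A2 \<in> carrier_mat p q'" "A3 \<in> carrier_mat q p'" "A4 \<in> carrier_mat q q'"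
    and B: "B1 \<in> carrier_mat p p'" "B2 \<in> carrier_mat p q'" "B3 \<in> carrier_mat q p'" "B4 \<in> carrier_mat q q'"
    and eq: "four_block_mat A1 A2 A3 A4 = four_block_mat B1 B2 B3 B4"
  shows "A2 = B2" "A3 = B3"
proof -
  show "A2 = B2"
  proof (rule eq_matI)
    fix i j assume "i < dim_row B2" "j < dim_col B2"
    then show "A2 $$ (i, j) = B2 $$ (i, j)"
      using arg_cong[OF eq, of "\<lambda>M. M $$ (i, p' + j)"] A B by simp
  qed (use A B in auto)
  show "A3 = B3"
  proof (rule eq_matI)
    fix i j assume "i < dim_row B3" "j < dim_col B3"
    then show "A3 $$ (i, j) = B3 $$ (i, j)"
      using arg_cong[OF eq, of "\<lambda>M. M $$ (p + i, j)"] A B by simp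
  qed (use A B in auto)
qed

theorem theorem2p12:
  fixes A B C X Y :: "complex mat" and E F :: "complex set" and n kA kB kC l :: nat
  assumes "A \<in> carrier_mat n n" and "B \<in> carrier_mat n n"
    and "C \<in> carrier_mat n n" and "X \<in> carrier_mat n n"
    and "quasiseparable_rank A = kA" and "quasiseparable_rank B = kB"
    and "quasiseparable_rank C = kC"
    and "E \<inter> F = {}" and "field_of_values A \<subseteq> E" and "field_of_values (- B) \<subseteq> F"
    and "A * X + X * B = C"
    and "Y \<in> off_diagonal_blocks X" and "Y \<noteq> 0\<^sub>m (dim_row Y) (dim_col Y)"
    and "l \<ge> 1"
  shows "ennreal (singular_value (1 + (kA + kB + kC) * l) Y / singular_value 1 Y)
           \<le> crouzeix_constant\<^sup>2 * zolotarev l E F"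
proof -
  note A = assms(1) and B = assms(2) and C = assms(3) and X = assms(4)
  obtain p X11 X12 X21 X22 where p: "1 \<le> p" "p < n" and sX: "split_block X p p = (X11, X12, X21, X22)"
    and Y: "Y = X12 \<or> Y = X21"
    using assms(12) X by (auto simp: off_diagonal_blocks_def)
  obtain A11 A12 A21 A22 where sA: "split_block A p p = (A11, A12, A21, A22)" by (cases "split_block A p p") auto
  obtain B11 B12 B21 B22 where sB: "split_block B p p = (B11, B12, B21, B22)" by (cases "split_block B p p") auto
  obtain C11 C12 C21 C22 where sC: "split_block C p p = (C11, C12, C21, C22)" by (cases "split_block C p p") auto
  define q where "q = n - p"
  have q: "0 < q" and n: "n = p + q" using p by (auto simp: q_def)
  have bA: "A11 \<in> carrier_mat p p" "A12 \<in> carrier_mat p q" "A21 \<in> carrier_mat q p" "A22 \<in> carrier_mat q q"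
    "A = four_block_mat A11 A12 A21 A22"
    using split_block[OF sA, of q q] A n by auto
  have bB: "B11 \<in> carrier_mat p p" "B12 \<in> carrier_mat p q" "B21 \<in> carrier_mat q p" "B22 \<in> carrier_mat q q"
    "B = four_block_mat B11 B12 B21 B22"
    using split_block[OF sB, of q q] B n by auto
  have bC: "C11 \<in> carrier_mat p p" "C12 \<in> carrier_mat p q" "C21 \<in> carrier_mat q p" "C22 \<in> carrier_mat q q"
    "C = four_block_mat C11 C12 C21 C22"
    using split_block[OF sC, of q q] C n by auto
  have bX: "X11 \<in> carrier_mat p p" "X12 \<in> carrier_mat p q" "X21 \<in> carrier_mat q p" "X22 \<in> carrier_mat q q"
    "X = four_block_mat X11 X12 X21 X22"
    using split_block[OF sX, of q q] X n by auto
  have rA: "rank_le kA A12" "rank_le kA A21"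
    using rank_le_off_diagonal_blocks[OF A _ sA] p assms(5) by auto
  have rB: "rank_le kB B12" "rank_le kB B21"
    using rank_le_off_diagonal_blocks[OF B _ sB] p assms(6) by auto
  have rC: "rank_le kC C12" "rank_le kC C21"
    using rank_le_off_diagonal_blocks[OF C _ sC] p assms(7) by auto
  have wA: "field_of_values A11 \<subseteq> E" "field_of_values A22 \<subseteq> E"
    using field_of_values_diagonal_blocks[OF bA(1-4)] assms(9) unfolding bA(5) by auto
  have negB: "- B = four_block_mat (- B11) (- B12) (- B21) (- B22)"
    unfolding bB(5) using bB(1-4) by (intro eq_matI) auto
  have wB: "field_of_values (- B11) \<subseteq> F" "field_of_values (- B22) \<subseteq> F"
    using field_of_values_diagonal_blocks[of "- B11" p "- B12" q "- B21" "- B22"] bB(1-4) assms(10)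
    unfolding negB by auto
  have cAX: "A11 * X12 \<in> carrier_mat p q" "A12 * X22 \<in> carrier_mat p q"
      "A21 * X11 \<in> carrier_mat q p" "A22 * X21 \<in> carrier_mat q p"
      "A11 * X11 + A12 * X21 \<in> carrier_mat p p" "A21 * X12 + A22 * X22 \<in> carrier_mat q q"
    and cXB: "X11 * B12 \<in> carrier_mat p q" "X12 * B22 \<in> carrier_mat p q"
      "X21 * B11 \<in> carrier_mat q p" "X22 * B21 \<in> carrier_mat q p"
      "X11 * B11 + X12 * B21 \<in> carrier_mat p p" "X21 * B12 + X22 * B22 \<in> carrier_mat q q"
    using bA(1-4) bB(1-4) bX(1-4) by auto
  note cAX' = add_carrier_mat[OF cAX(2), of "A11 * X12"] add_carrier_mat[OF cAX(4), of "A21 * X11"]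
  note cXB' = add_carrier_mat[OF cXB(2), of "X11 * B12"] add_carrier_mat[OF cXB(4), of "X21 * B11"]
  have "four_block_mat
      ((A11 * X11 + A12 * X21) + (X11 * B11 + X12 * B21)) ((A11 * X12 + A12 * X22) + (X11 * B12 + X12 * B22))
      ((A21 * X11 + A22 * X21) + (X21 * B11 + X22 * B21)) ((A21 * X12 + A22 * X22) + (X21 * B12 + X22 * B22))
    = A * X + X * B"
    unfolding bA(5) bB(5) bX(5) mult_four_block_mat[OF bA(1-4) bX(1-4)] mult_four_block_mat[OF bX(1-4) bB(1-4)]
    by (rule add_four_block_mat[symmetric, OF cAX(5) cAX'(1) cAX'(2) cAX(6) cXB(5) cXB'(1) cXB'(2) cXB(6)])
  also have "\<dots> = four_block_mat C11 C12 C21 C22" using assms(11) bC(5) by simp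
  finally have eq: "(A11 * X12 + A12 * X22) + (X11 * B12 + X12 * B22) = C12"
    "(A21 * X11 + A22 * X21) + (X21 * B11 + X22 * B21) = C21"
    using four_block_mat_inject_off_diagonal[OF
        add_carrier_mat[OF cXB(5)] add_carrier_mat[OF cXB'(1)] add_carrier_mat[OF cXB'(2)] add_carrier_mat[OF cXB(6)]
        bC(1-4)] by blast+
  \<comment> \<open>\<open>U - (- Z)\<close> is the Sylvester expression with \<open>D\<close> the
    negative of a diagonal block of \<open>B\<close>; the right-hand sides solve the block equation
    for it.\<close>
  have cancel12: "U - (- Z) = ((U + V) + (W + Z)) - V - W"
    and cancel21: "U - (- Z) = ((V + U) + (Z + W)) - V - W"
    if "U \<in> carrier_mat r s" "V \<in> carrier_mat r s" "W \<in> carrier_mat r s" "Z \<in> carrier_mat r s"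
    for U V W Z :: "complex mat" and r s
    using that by (auto intro!: eq_matI)
  have neg: "X12 * (- B22) = - (X12 * B22)" "X21 * (- B11) = - (X21 * B11)"
    using bX(2,3) bB(1,4) by simp_all
  show ?thesis
    using Y
  proof
    assume Y: "Y = X12"
    have "A11 * X12 - X12 * (- B22) = C12 - A12 * X22 - X11 * B12"
      unfolding eq(1)[symmetric] neg
      by (rule cancel12[OF cAX(1,2) cXB(1,2)])
    moreover have "rank_le (kC + kA + kB) (C12 - A12 * X22 - X11 * B12)"
      by (intro rank_le_diff[of _ p q] minus_carrier_mat bC(2) cAX(2) cXB(1) rC(1)
          rank_le_mult_right[OF bA(2) bX(4) rA(1)] rank_le_mult_left[OF bX(1) bB(2) rB(1)])
    ultimately have G: "rank_le (kA + kB + kC) (A11 * X12 - X12 * (- B22))" by (simp add: ac_simps)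
    have "Y \<noteq> 0\<^sub>m p q" using assms(13) bX(2) Y by auto
    then show ?thesis
      using sylvester_singular_value_ratio[OF bA(1) _ bX(2) _ q _ G assms(14,8) wA(1) wB(2)] bB(4) p Y by simp
  next
    assume Y: "Y = X21"
    have "A22 * X21 - X21 * (- B11) = C21 - A21 * X11 - X22 * B21"
      unfolding eq(2)[symmetric] neg
      by (rule cancel21[OF cAX(4,3) cXB(4,3)])
    moreover have "rank_le (kC + kA + kB) (C21 - A21 * X11 - X22 * B21)"
      by (intro rank_le_diff[of _ q p] minus_carrier_mat bC(3) cAX(3) cXB(4) rC(2)
          rank_le_mult_right[OF bA(3) bX(1) rA(2)] rank_le_mult_left[OF bX(4) bB(3) rB(2)])
    ultimately have G: "rank_le (kA + kB + kC) (A22 * X21 - X21 * (- B11))" by (simp add: ac_simps)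
    have "Y \<noteq> 0\<^sub>m q p" using assms(13) bX(3) Y by auto
    then show ?thesis
      using sylvester_singular_value_ratio[OF bA(4) _ bX(3) q _ _ G assms(14,8) wA(2) wB(1)] bB(1) p Y by simp
  qed
qed

end
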